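(* Let $\mathbf{U}$ be a small universe of sets, with the set associated to $A\in\mathbf{U}$ denoted $[A]$, and let $u\colon\mathbf{Set}\to\mathbf{Set}$ be the polynomial functor $u(X)=\sum_{A\in\mathbf{U}}X^{[A]}$. Let $\mathcal{C}$ be a small category with associated polynomial comonad $k_{\mathcal{C}}$ on $\mathbf{Set}$. Then the category corresponding to the polynomial comonad $\mathrm{Lan}_u(u\circ k_{\mathcal{C}})$ is (isomorphic to) the $\mathbf{U}$-ary product completion of $\mathcal{C}$.
   Context: A small universe consists of a set $\mathbf{U}$ together with a set $[A]$ for each $A\in\mathbf{U}$. Polynomial functors $\mathbf{Set}\to\mathbf{Set}$ are coproducts of representables $\sum_{i\in I}\mathbf{Set}(A_i,-)$. Polynomial comonads and categories: for a small category $\mathcal{C}$ and object $c$, let $\mathcal{C}[c]=\sum_{c'\in\mathrm{Ob}\,\mathcal{C}}\mathcal{C}(c,c')$ be the set of morphisms out of $c$. The comonad $k_{\mathcal{C}}$ on $\mathbf{Set}$ has underlying functor $X\mapsto\sum_{c\in\mathrm{Ob}\,\mathcal{C}}\mathbf{Set}(\mathcal{C}[c],X)$, counit $(c,x)\mapsto x(\mathrm{id}_c)$, and comultiplication $(c,x)\mapsto\big(c,\ f\mapsto(\mathrm{cod}(f),\ f'\mapsto x(f'\circ f))\big)$. By a theorem of Ahman and Uustalu, every comonad on $\mathbf{Set}$ with polynomial underlying functor is isomorphic to $k_{\mathcal{C}}$ for a small category $\mathcal{C}$, unique up to isomorphism: the category corresponding to the comonad. $\mathrm{Lan}_q(p)$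 denotes the left Kan extension of $p$ along $q$, with universal unit $p\Rightarrow\mathrm{Lan}_q(p)\circ q$ giving a bijection between maps $\mathrm{Lan}_q(p)\Rightarrow r$ and maps $p\Rightarrow r\circ q$. For a comonad $(k,\epsilon,\delta)$ and functor $p$, put $L=\mathrm{Lan}_p(p\circ k)$; it is a comonad whose counit $L\Rightarrow\mathrm{id}$ corresponds to $p\epsilon\colon pk\Rightarrow p$ and whose comultiplication $L\Rightarrow LL$ corresponds to $pk\xrightarrow{p\delta}pkk\Rightarrow Lpk\Rightarrow LLp$ (the last two maps being Kan extension units). For polynomial $p,k$ on $\mathbf{Set}$, the functor $L$ is polynomial. The $\mathbf{U}$-ary product completion of $\mathcal{C}$ is the category of formal $\mathbf{U}$-indexed products: objects are pairs $(A,c)$ with $A\in\mathbf{U}$ and $c\colon[A]\to\mathrm{Ob}\,\mathcal{C}$; morphisms $(A,c)\to(A',c')$ are pairs $(\varphi,f)$ with $\varphi\colon[A']\to[A]$ a function and $f_{a'}\colon c_{\varphi(a')}\to c'_{a'}$ in $\mathcal{C}$ for each $a'\in[A']$; identities and composition are the evident ones (composing the functions and the components). *)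

theory Defs
  imports "HOL-Library.FuncSet"
begin

text \<open>
  The category \<open>Set\<close> is the category of small sets of a Grothendieck universe. In the
  set-theoretic picture the type \<open>'v\<close> is the universe \<open>V\<^sub>\<kappa>\<close>, \<open>\<kappa>\<close> inaccessible, whose members are
  precisely the subsets of \<open>V\<^sub>\<kappa>\<close> of cardinality below \<open>\<kappa>\<close>. Uncountability of \<open>\<kappa>\<close> is not imposed, so
  \<open>\<kappa> = \<omega>\<close> (finite sets) is also covered. A function \<open>X \<rightarrow> Y\<close> is an element of \<open>X \<rightarrow>\<^sub>E Y\<close>, so
  that equality of functions is HOL equality; composition is \<^const>\<open>compose\<close>.
\<close>

definition set_universe :: "'v itself \<Rightarrow> bool" where
  "set_universe _ \<longleftrightarrow> infinite (UNIV :: 'v set) \<and> regularCard (card_of (UNIV :: 'v set)) \<and>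
    (\<forall>X :: 'v set. (card_of X, card_of (UNIV :: 'v set)) \<in> ordLess \<longrightarrow>
      (card_of (Pow X), card_of (UNIV :: 'v set)) \<in> ordLess)"

definition small :: "'v itself \<Rightarrow> 'a set \<Rightarrow> bool" where
  "small _ A \<longleftrightarrow> (card_of A, card_of (UNIV :: 'v set)) \<in> ordLess"

definition Sets :: "'v set set" where
  "Sets = {X :: 'v set. small TYPE('v) X}"


subsection \<open>Functors from Set to Set and natural transformations\<close>

text \<open>\<open>fmor F X Y f\<close> is the action of \<open>F\<close> on \<open>f : X \<rightarrow> Y\<close>.\<close>

record 'v setfun =
  fobj :: "'v set \<Rightarrow> 'v set"
  fmor :: "'v set \<Rightarrow> 'v set \<Rightarrow> ('v \<Rightarrow> 'v) \<Rightarrow> 'v \<Rightarrow> 'v"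

locale set_functor =
  fixes F :: "'v setfun"
  assumes obj_closed: "X \<in> Sets \<Longrightarrow> fobj F X \<in> Sets"
    and mor_closed: "\<lbrakk>X \<in> Sets; Y \<in> Sets; f \<in> X \<rightarrow>\<^sub>E Y\<rbrakk> \<Longrightarrow> fmor F X Y f \<in> fobj F X \<rightarrow>\<^sub>E fobj F Y"
    and mor_id: "X \<in> Sets \<Longrightarrow> fmor F X X (\<lambda>x\<in>X. x) = (\<lambda>v\<in>fobj F X. v)"
    and mor_comp: "\<lbrakk>X \<in> Sets; Y \<in> Sets; Z \<in> Sets; f \<in> X \<rightarrow>\<^sub>E Y; g \<in> Y \<rightarrow>\<^sub>E Z\<rbrakk> \<Longrightarrow>
      fmor F X Z (compose X g f) = compose (fobj F X) (fmor F Y Z g) (fmor F X Y f)"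

definition id_functor :: "'v setfun" where
  "id_functor = \<lparr>fobj = (\<lambda>X. X), fmor = (\<lambda>X Y f. f)\<rparr>"

definition comp_functor :: "'v setfun \<Rightarrow> 'v setfun \<Rightarrow> 'v setfun"  (infixl "\<circ>\<^sub>F" 70) where
  "G \<circ>\<^sub>F F = \<lparr>fobj = (\<lambda>X. fobj G (fobj F X)),
    fmor = (\<lambda>X Y f. fmor G (fobj F X) (fobj F Y) (fmor F X Y f))\<rparr>"

locale nat_trans =
  fixes F G :: "'v setfun" and \<alpha> :: "'v set \<Rightarrow> 'v \<Rightarrow> 'v"
  assumes component: "X \<in> Sets \<Longrightarrow> \<alpha> X \<in> fobj F X \<rightarrow>\<^sub>E fobj G X"
    and natural: "\<lbrakk>X \<in> Sets; Y \<in> Sets; f \<in> X \<rightarrow>\<^sub>E Y\<rbrakk> \<Longrightarrow>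
      compose (fobj F X) (\<alpha> Y) (fmor F X Y f) = compose (fobj F X) (fmor G X Y f) (\<alpha> X)"

definition nt_eq :: "('v set \<Rightarrow> 'v \<Rightarrow> 'v) \<Rightarrow> ('v set \<Rightarrow> 'v \<Rightarrow> 'v) \<Rightarrow> bool" where
  "nt_eq \<alpha> \<beta> \<longleftrightarrow> (\<forall>X\<in>Sets. \<alpha> X = \<beta> X)"

text \<open>
  \<open>vcomp F \<beta> \<alpha>\<close> is the composite \<open>\<beta> \<alpha>\<close> of \<open>\<alpha> : F \<Rightarrow> G\<close> and \<open>\<beta> : G \<Rightarrow> H\<close>;
  \<open>whisk_left K F G \<alpha>\<close> is \<open>K \<alpha> : K F \<Rightarrow> K G\<close> and \<open>whisk_right \<alpha> K\<close> is \<open>\<alpha> K : F K \<Rightarrow> G K\<close>.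
\<close>

definition nt_id :: "'v setfun \<Rightarrow> 'v set \<Rightarrow> 'v \<Rightarrow> 'v" where
  "nt_id F X = (\<lambda>v\<in>fobj F X. v)"

definition vcomp :: "'v setfun \<Rightarrow> ('v set \<Rightarrow> 'v \<Rightarrow> 'v) \<Rightarrow> ('v set \<Rightarrow> 'v \<Rightarrow> 'v) \<Rightarrow> 'v set \<Rightarrow> 'v \<Rightarrow> 'v" where
  "vcomp F \<beta> \<alpha> X = compose (fobj F X) (\<beta> X) (\<alpha> X)"

definition whisk_left ::
  "'v setfun \<Rightarrow> 'v setfun \<Rightarrow> 'v setfun \<Rightarrow> ('v set \<Rightarrow> 'v \<Rightarrow> 'v) \<Rightarrow> 'v set \<Rightarrow> 'v \<Rightarrow> 'v" where
  "whisk_left K F G \<alpha> X = fmor K (fobj F X) (fobj G X) (\<alpha> X)"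

definition whisk_right :: "('v set \<Rightarrow> 'v \<Rightarrow> 'v) \<Rightarrow> 'v setfun \<Rightarrow> 'v set \<Rightarrow> 'v \<Rightarrow> 'v" where
  "whisk_right \<alpha> K X = \<alpha> (fobj K X)"


subsection \<open>Comonads on Set\<close>

record 'v comonad_data =
  func :: "'v setfun"
  counit :: "'v set \<Rightarrow> 'v \<Rightarrow> 'v"
  comult :: "'v set \<Rightarrow> 'v \<Rightarrow> 'v"

locale comonad =
  fixes k :: "'v comonad_data"
  assumes func_functor: "set_functor (func k)"
    and counit_nat: "nat_trans (func k) id_functor (counit k)"
    and comult_nat: "nat_trans (func k) (func k \<circ>\<^sub>F func k) (comult k)"
    and counit_left:
      "nt_eq (vcomp (func k) (whisk_right (counit k) (func k)) (comult k)) (nt_id (func k))"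
    and counit_right:
      "nt_eq (vcomp (func k) (whisk_left (func k) (func k) id_functor (counit k)) (comult k))
         (nt_id (func k))"
    and coassoc:
      "nt_eq (vcomp (func k) (whisk_right (comult k) (func k)) (comult k))
         (vcomp (func k) (whisk_left (func k) (func k) (func k \<circ>\<^sub>F func k) (comult k)) (comult k))"

definition comonad_isomorphic :: "'v comonad_data \<Rightarrow> 'v comonad_data \<Rightarrow> bool" where
  "comonad_isomorphic k l \<longleftrightarrow> (\<exists>\<alpha>. nat_trans (func k) (func l) \<alpha> \<and>
     (\<forall>X\<in>Sets. bij_betw (\<alpha> X) (fobj (func k) X) (fobj (func l) X)) \<and>
     nt_eq (vcomp (func k) (counit l) \<alpha>) (counit k) \<and>
     nt_eq (vcomp (func k) (comult l) \<alpha>)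
       (vcomp (func k) (whisk_right \<alpha> (func l))
         (vcomp (func k) (whisk_left (func k) (func k) (func l) \<alpha>) (comult k))))"


subsection \<open>Left Kan extensions\<close>

definition is_left_kan ::
  "'v setfun \<Rightarrow> 'v setfun \<Rightarrow> 'v setfun \<Rightarrow> ('v set \<Rightarrow> 'v \<Rightarrow> 'v) \<Rightarrow> bool" where
  "is_left_kan q p L \<eta> \<longleftrightarrow>
     set_functor L \<and> nat_trans p (L \<circ>\<^sub>F q) \<eta> \<and>
     (\<forall>r \<theta>. set_functor r \<and> nat_trans p (r \<circ>\<^sub>F q) \<theta> \<longrightarrow>
       (\<exists>\<sigma>. nat_trans L r \<sigma> \<and> nt_eq (vcomp p (whisk_right \<sigma> q) \<eta>) \<theta> \<and>
         (\<forall>\<sigma>'. nat_trans L r \<sigma>' \<and> nt_eq (vcomp p (whisk_right \<sigma>' q) \<eta>) \<theta> \<longrightarrow> nt_eq \<sigma>' \<sigma>)))"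

text \<open>
  \<open>l\<close> is \<open>Lan\<^sub>p (p \<circ> k)\<close> (determined only up to isomorphism) with its comonad structure: the
  counit corresponds to \<open>p \<epsilon>\<close> and the comultiplication to
  \<open>p k \<rightarrow> p k k \<rightarrow> l p k \<rightarrow> l l p\<close>, the maps being \<open>p \<delta>\<close>, \<open>\<eta> k\<close> and \<open>l \<eta>\<close>.
\<close>

definition is_lan_comonad :: "'v setfun \<Rightarrow> 'v comonad_data \<Rightarrow> 'v comonad_data \<Rightarrow> bool" where
  "is_lan_comonad p k l \<longleftrightarrow> (let K = func k; L = func l in \<exists>\<eta>.
     is_left_kan p (p \<circ>\<^sub>F K) L \<eta> \<and>
     nat_trans L id_functor (counit l) \<and>
     nt_eq (vcomp (p \<circ>\<^sub>F K) (whisk_right (counit l) p) \<eta>)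
       (whisk_left p K id_functor (counit k)) \<and>
     nat_trans L (L \<circ>\<^sub>F L) (comult l) \<and>
     nt_eq (vcomp (p \<circ>\<^sub>F K) (whisk_right (comult l) p) \<eta>)
       (vcomp (p \<circ>\<^sub>F K) (whisk_left L (p \<circ>\<^sub>F K) (L \<circ>\<^sub>F p) \<eta>)
         (vcomp (p \<circ>\<^sub>F K) (whisk_right \<eta> K)
           (whisk_left p K (K \<circ>\<^sub>F K) (comult k)))))"


subsection \<open>Polynomial functors\<close>

text \<open>
  \<open>poly I B\<close> is the functor sending \<open>X\<close> to the sum of the function sets \<open>B i \<rightarrow> X\<close> over \<open>i \<in> I\<close>.
  To make its values sets of elements of \<open>'v\<close>, the pairs \<open>(i, x)\<close> are coded by
  \<open>poly_code I B\<close>, an injection on \<open>poly_dom I B\<close>, the set of all such pairs; it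
  exists if \<open>set_universe TYPE('v)\<close> holds and \<open>I\<close> and all \<open>B i\<close> are small.
\<close>

definition poly_dom :: "'i set \<Rightarrow> ('i \<Rightarrow> 'b set) \<Rightarrow> ('i \<times> ('b \<Rightarrow> 'v)) set" where
  "poly_dom I B = (SIGMA i:I. B i \<rightarrow>\<^sub>E UNIV)"

definition poly_code :: "'i set \<Rightarrow> ('i \<Rightarrow> 'b set) \<Rightarrow> 'i \<times> ('b \<Rightarrow> 'v) \<Rightarrow> 'v" where
  "poly_code I B = (SOME e. inj_on e (poly_dom I B))"

definition poly_decode :: "'i set \<Rightarrow> ('i \<Rightarrow> 'b set) \<Rightarrow> 'v \<Rightarrow> 'i \<times> ('b \<Rightarrow> 'v)" where
  "poly_decode I B = inv_into (poly_dom I B) (poly_code I B)"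

definition poly_obj :: "'i set \<Rightarrow> ('i \<Rightarrow> 'b set) \<Rightarrow> 'v set \<Rightarrow> 'v set" where
  "poly_obj I B X = poly_code I B ` (SIGMA i:I. B i \<rightarrow>\<^sub>E X)"

definition poly :: "'i set \<Rightarrow> ('i \<Rightarrow> 'b set) \<Rightarrow> 'v setfun" where
  "poly I B = \<lparr>fobj = poly_obj I B,
     fmor = (\<lambda>X Y f. \<lambda>v\<in>poly_obj I B X.
       case poly_decode I B v of (i, x) \<Rightarrow> poly_code I B (i, compose (B i) f x))\<rparr>"


subsection \<open>Categories and their comonads\<close>

record ('o, 'm) cat =
  Ob :: "'o set"
  Arr :: "'m set"
  Dom :: "'m \<Rightarrow> 'o"
  Cod :: "'m \<Rightarrow> 'o"
  Ide :: "'o \<Rightarrow> 'm"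
  Comp :: "'m \<Rightarrow> 'm \<Rightarrow> 'm"  \<comment> \<open>\<open>Comp C g f\<close> is \<open>g \<circ> f\<close>\<close>

locale category =
  fixes C :: "('o, 'm) cat"
  assumes dom_ob: "f \<in> Arr C \<Longrightarrow> Dom C f \<in> Ob C"
    and cod_ob: "f \<in> Arr C \<Longrightarrow> Cod C f \<in> Ob C"
    and ide_arr: "c \<in> Ob C \<Longrightarrow> Ide C c \<in> Arr C"
    and dom_ide: "c \<in> Ob C \<Longrightarrow> Dom C (Ide C c) = c"
    and cod_ide: "c \<in> Ob C \<Longrightarrow> Cod C (Ide C c) = c"
    and comp_arr: "\<lbrakk>f \<in> Arr C; g \<in> Arr C; Dom C g = Cod C f\<rbrakk> \<Longrightarrow> Comp C g f \<in> Arr C"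
    and dom_comp: "\<lbrakk>f \<in> Arr C; g \<in> Arr C; Dom C g = Cod C f\<rbrakk> \<Longrightarrow> Dom C (Comp C g f) = Dom C f"
    and cod_comp: "\<lbrakk>f \<in> Arr C; g \<in> Arr C; Dom C g = Cod C f\<rbrakk> \<Longrightarrow> Cod C (Comp C g f) = Cod C g"
    and comp_ide_right: "f \<in> Arr C \<Longrightarrow> Comp C f (Ide C (Dom C f)) = f"
    and comp_ide_left: "f \<in> Arr C \<Longrightarrow> Comp C (Ide C (Cod C f)) f = f"
    and comp_assoc: "\<lbrakk>f \<in> Arr C; g \<in> Arr C; h \<in> Arr C; Dom C g = Cod C f; Dom C h = Cod C g\<rbrakk> \<Longrightarrow>
      Comp C h (Comp C g f) = Comp C (Comp C h g) f"

definition small_category :: "'v itself \<Rightarrow> ('o, 'm) cat \<Rightarrow> bool" where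
  "small_category V C \<longleftrightarrow> category C \<and> small V (Ob C) \<and> small V (Arr C)"

definition category_isomorphic :: "('o, 'm) cat \<Rightarrow> ('p, 'n) cat \<Rightarrow> bool" where
  "category_isomorphic C D \<longleftrightarrow> (\<exists>Fo Fm. bij_betw Fo (Ob C) (Ob D) \<and> bij_betw Fm (Arr C) (Arr D) \<and>
     (\<forall>f\<in>Arr C. Dom D (Fm f) = Fo (Dom C f) \<and> Cod D (Fm f) = Fo (Cod C f)) \<and>
     (\<forall>c\<in>Ob C. Fm (Ide C c) = Ide D (Fo c)) \<and>
     (\<forall>f\<in>Arr C. \<forall>g\<in>Arr C. Dom C g = Cod C f \<longrightarrow> Fm (Comp C g f) = Comp D (Fm g) (Fm f)))"

definition out :: "('o, 'm) cat \<Rightarrow> 'o \<Rightarrow> 'm set" where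
  "out C c = {f \<in> Arr C. Dom C f = c}"

definition cat_comonad :: "('o, 'm) cat \<Rightarrow> 'v comonad_data" where
  "cat_comonad C = (let I = Ob C; B = out C in
     \<lparr>func = poly I B,
      counit = (\<lambda>X. \<lambda>v\<in>poly_obj I B X. case poly_decode I B v of (c, x) \<Rightarrow> x (Ide C c)),
      comult = (\<lambda>X. \<lambda>v\<in>poly_obj I B X. case poly_decode I B v of (c, x) \<Rightarrow>
        poly_code I B (c, \<lambda>f\<in>out C c.
          poly_code I B (Cod C f, \<lambda>f'\<in>out C (Cod C f). x (Comp C f' f))))\<rparr>)"

definition corresponding_category :: "'v comonad_data \<Rightarrow> ('o, 'm) cat \<Rightarrow> bool" where
  "corresponding_category k E \<longleftrightarrow>
     small_category TYPE('v) E \<and> comonad_isomorphic k (cat_comonad E)"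


subsection \<open>The product completion\<close>

text \<open>
  The universe is the set \<open>U\<close> together with the set \<open>El A\<close> for each \<open>A \<in> U\<close>. A morphism
  carries its source and target: it is \<open>((A, c), (A', c'), \<phi>, f)\<close>.
\<close>

type_synonym ('a, 'b, 'o) pc_ob = "'a \<times> ('b \<Rightarrow> 'o)"
type_synonym ('a, 'b, 'o, 'm) pc_arr =
  "('a, 'b, 'o) pc_ob \<times> ('a, 'b, 'o) pc_ob \<times> ('b \<Rightarrow> 'b) \<times> ('b \<Rightarrow> 'm)"

definition product_completion ::
  "'a set \<Rightarrow> ('a \<Rightarrow> 'b set) \<Rightarrow> ('o, 'm) cat \<Rightarrow> (('a, 'b, 'o) pc_ob, ('a, 'b, 'o, 'm) pc_arr) cat" where
  "product_completion U El C =
    (let Obs = (SIGMA A:U. El A \<rightarrow>\<^sub>E Ob C) in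
    \<lparr>Ob = Obs,
     Arr = {((A, c), (A', c'), \<phi>, f) | A c A' c' \<phi> f.
       (A, c) \<in> Obs \<and> (A', c') \<in> Obs \<and> \<phi> \<in> El A' \<rightarrow>\<^sub>E El A \<and>
       f \<in> (\<Pi>\<^sub>E a'\<in>El A'. {h \<in> Arr C. Dom C h = c (\<phi> a') \<and> Cod C h = c' a'})},
     Dom = (\<lambda>(s, t, \<phi>, f). s),
     Cod = (\<lambda>(s, t, \<phi>, f). t),
     Ide = (\<lambda>(A, c). ((A, c), (A, c), \<lambda>a\<in>El A. a, \<lambda>a\<in>El A. Ide C (c a))),
     Comp = (\<lambda>(s', t', \<phi>', f') (s, t, \<phi>, f).
       (s, t', compose (El (fst t')) \<phi> \<phi>', \<lambda>a\<in>El (fst t'). Comp C (f' a) (f (\<phi>' a))))\<rparr>)"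

end

(*
  By Yoneda, the left Kan extension along u of a polynomial functor with exponents P_j has exponents
  u(P_j). The composite u \<circ> k_C is a sum over the objects (A, c) of the completion, with exponents the
  sets of pairs (a, g), a in [A], g a morphism out of c(a); and u of this set consists of an A' in U
  together with, for each a' in [A'], an index \<phi>(a') and a morphism out of c(\<phi>(a')), i.e. of a
  morphism out of (A, c) in the completion. So Lan_u (u \<circ> k_C) is the functor of the comonad of the
  completion, and its counit and comultiplication, read off on the unit of the extension, are
  evaluation at identities and composition. Comonads satisfying the universal property are isomorphic,
  and a category is recovered from its comonad by Yoneda.
*)
theory Submission
  imports Defs
begin

text \<open>Two circumstances shape the development. Values of functors must be subsets of
  \<open>'v\<close>, so an element \<open>(i, x)\<close> of a summand is present only through its
  code. One code has to serve all sets \<open>X\<close>, and its existence rests on the estimate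
  \<open>card_PiE_small_le\<close>, where regularity and closure under power sets enter. For the
  same reason the exponents, which are sets of morphisms or of pairs in other types, are not
  themselves members of \<open>Sets\<close>: every use of Yoneda passes through a chosen copy of the
  exponent inside \<open>'v\<close> (\<open>fibre_encode\<close>, \<open>fan_code\<close>), and the
  copying map plays the part of the identity.

  Moreover, a left Kan extension is given only up to isomorphism, and \<open>is_lan_comonad\<close>
  does not list the comonad laws. They are not derived from the universal property: they are
  verified for the comonad of a category, where they amount to the category laws, and carried to an
  arbitrary \<open>l\<close> along an isomorphism (\<open>comonad_transport\<close>).\<close>

subsection \<open>Smallness\<close>

lemma small_inj_on:
  assumes "small V B" "inj_on f A" "f ` A \<subseteq> B"
  shows "small V A"
  using assms card_of_ordLeq[of A B] ordLeq_ordLess_trans unfolding small_def by blast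

lemma small_subset: "small V B \<Longrightarrow> A \<subseteq> B \<Longrightarrow> small V A"
  by (rule small_inj_on[where f = id]) auto

lemma small_image: "small V A \<Longrightarrow> small V (f ` A)"
  using card_of_image[of f A] ordLeq_ordLess_trans unfolding small_def by blast

lemma small_Sigma:
  assumes V: "set_universe TYPE('v)" and "small TYPE('v) A"
    and "\<And>a. a \<in> A \<Longrightarrow> small TYPE('v) (B a)"
  shows "small TYPE('v) (Sigma A B)"
proof -
  \<comment> \<open>Regularity of an infinite cardinal is used in its additive form: a sum of fewer
    than that many sets, each of smaller cardinality, is again smaller.\<close>
  have "stable (card_of (UNIV :: 'v set))"
    using V regularCard_stable[OF card_of_Card_order, of "UNIV :: 'v set"]
    unfolding set_universe_def by (simp add: Field_card_of)
  then show ?thesis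
    using assms(2,3) stable_elim unfolding small_def by blast
qed

lemma small_encode:
  assumes "small TYPE('v) A"
  obtains e :: "'a \<Rightarrow> 'v" where "inj_on e A" "e ` A \<in> Sets"
proof -
  obtain e :: "'a \<Rightarrow> 'v" where "inj_on e A"
    using assms card_of_ordLeq[of A "UNIV :: 'v set"] ordLess_imp_ordLeq
    unfolding small_def by blast
  then show thesis
    using that small_image[OF assms, of e] unfolding Sets_def by blast
qed

text \<open>\<open>set_universe\<close> bounds the power sets of subsets of \<open>'v\<close> only,
  so \<open>A\<close> is copied into \<open>'v\<close>; taking images under an injection is
  injective on subsets.\<close>

lemma small_Pow:
  assumes "set_universe TYPE('v)" "small TYPE('v) A"
  shows "small TYPE('v) (Pow A)"
proof -
  obtain e :: "'a \<Rightarrow> 'v" where e: "inj_on e A" "e ` A \<in> Sets"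
    using small_encode assms(2) .
  have "small TYPE('v) (Pow (e ` A))"
    using assms(1) e(2) unfolding set_universe_def Sets_def small_def by auto
  then show ?thesis
    by (rule small_inj_on[where f = "image e"]) (use e(1) in \<open>auto intro: inj_on_image_Pow\<close>)
qed

text \<open>A function is replaced by its graph over \<open>A\<close>, a subset of
  \<open>Sigma A B\<close>. The graph determines the function because all members of the product
  agree outside \<open>A\<close>, where they are \<open>undefined\<close>.\<close>

lemma small_PiE:
  assumes "set_universe TYPE('v)" "small TYPE('v) A"
    and "\<And>a. a \<in> A \<Longrightarrow> small TYPE('v) (B a)"
  shows "small TYPE('v) (Pi\<^sub>E A B)"
proof -
  have "small TYPE('v) (Pow (Sigma A B))"
    using assms by (intro small_Pow small_Sigma)
  moreover have "inj_on (\<lambda>f. (\<lambda>a. (a, f a)) ` A) (Pi\<^sub>E A B)"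
  proof (rule inj_onI)
    fix f g assume fg: "f \<in> Pi\<^sub>E A B" "g \<in> Pi\<^sub>E A B"
      and "(\<lambda>a. (a, f a)) ` A = (\<lambda>a. (a, g a)) ` A"
    then have "f a = g a" if "a \<in> A" for a
      using that by auto
    then show "f = g"
      using fg PiE_ext by blast
  qed
  ultimately show ?thesis
    by (rule small_inj_on) auto
qed

text \<open>\<open>card_of UNIV\<close> is a well-order on \<open>'v\<close> of least possible type.
  Hence its strict initial segments are small, and adjoining the point \<open>a\<close> keeps them
  so.\<close>

lemma small_under:
  assumes "set_universe TYPE('v)"
  shows "small TYPE('v) (under (card_of (UNIV :: 'v set)) a)"
proof -
  have inf: "infinite (UNIV :: 'v set)"
    using assms unfolding set_universe_def by blast
  have "small TYPE('v) (underS (card_of (UNIV :: 'v set)) a)"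
    unfolding small_def by (rule card_of_underS[OF card_of_Card_order]) (simp add: Field_card_of)
  moreover have "small TYPE('v) {a}"
    using inf card_of_ordLess2[of "UNIV :: 'v set" "{a}"] finite_imageI[of "{a}"]
    unfolding small_def by (metis UNIV_not_empty finite.emptyI finite.insertI)
  ultimately have "small TYPE('v) (underS (card_of (UNIV :: 'v set)) a \<union> {a})"
    unfolding small_def by (rule card_of_Un_ordLess_infinite[OF inf])
  then show ?thesis
    by (rule small_subset) (auto simp: under_def underS_def)
qed

text \<open>
  By regularity a function from a small set into the universe is bounded, and the bounded
  functions form a union, indexed by the universe, of small sets.
\<close>

lemma card_PiE_small_le:
  assumes V: "set_universe TYPE('v)" and B: "small TYPE('v) B"
  shows "(card_of (B \<rightarrow>\<^sub>E (UNIV :: 'v set)), card_of (UNIV :: 'v set)) \<in> ordLeq"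
proof -
  let ?r = "card_of (UNIV :: 'v set)"
  have "f \<in> (\<Union>a. B \<rightarrow>\<^sub>E under ?r a)" if f: "f \<in> B \<rightarrow>\<^sub>E UNIV" for f
  proof -
    have "wo_rel ?r"
      using card_of_Well_order unfolding wo_rel_def by blast
    then have "relChain ?r (under ?r)"
      unfolding relChain_def under_def using wo_rel.TRANS by (blast dest: transD)
    moreover have "f ` B \<subseteq> (\<Union>a\<in>Field ?r. under ?r a)"
      using well_order_on_Well_order[OF card_of_well_order_on[of "UNIV :: 'v set"]]
      unfolding under_def Field_card_of well_order_on_def linear_order_on_def partial_order_on_def
        preorder_on_def refl_on_def by auto
    ultimately obtain a where "f ` B \<subseteq> under ?r a"
      using regularCard_UNION[OF card_of_Card_order] V small_image[OF B, of f]
      unfolding set_universe_def small_def by blast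
    then show ?thesis
      using f by (auto simp: PiE_iff)
  qed
  then have "(card_of (B \<rightarrow>\<^sub>E (UNIV :: 'v set)), card_of (\<Union>a. B \<rightarrow>\<^sub>E under ?r a)) \<in> ordLeq"
    by (intro card_of_mono1) blast
  moreover have "(card_of (\<Union>a. B \<rightarrow>\<^sub>E under ?r a), ?r) \<in> ordLeq"
  proof (rule card_of_UNION_ordLeq_infinite)
    show "infinite (UNIV :: 'v set)"
      using V unfolding set_universe_def by blast
    show "\<forall>a\<in>UNIV. (card_of (B \<rightarrow>\<^sub>E under ?r a), ?r) \<in> ordLeq"
      by (intro ballI ordLess_imp_ordLeq small_PiE[OF V B small_under[OF V], unfolded small_def])
  qed (rule ordLeq_refl[OF card_of_Card_order])
  ultimately show ?thesis
    by (rule ordLeq_transitive)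
qed


subsection \<open>Functors and natural transformations\<close>

lemma nat_trans_apply:
  assumes "nat_trans F G \<alpha>" "X \<in> Sets" "v \<in> fobj F X"
  shows "\<alpha> X v \<in> fobj G X"
  using nat_trans.component[OF assms(1,2)] assms(3) by blast

lemma nat_trans_natural:
  assumes "nat_trans F G \<alpha>" "X \<in> Sets" "Y \<in> Sets" "f \<in> X \<rightarrow>\<^sub>E Y" "v \<in> fobj F X"
  shows "\<alpha> Y (fmor F X Y f v) = fmor G X Y f (\<alpha> X v)"
  using fun_cong[OF nat_trans.natural[OF assms(1-4)], of v] assms(5) by (simp add: compose_eq)

lemma nat_transI:
  assumes "\<And>X. X \<in> Sets \<Longrightarrow> \<alpha> X \<in> extensional (fobj F X)"
    and "\<And>X v. X \<in> Sets \<Longrightarrow> v \<in> fobj F X \<Longrightarrow> \<alpha> X v \<in> fobj G X"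
    and "\<And>X Y f v. \<lbrakk>X \<in> Sets; Y \<in> Sets; f \<in> X \<rightarrow>\<^sub>E Y; v \<in> fobj F X\<rbrakk> \<Longrightarrow>
      \<alpha> Y (fmor F X Y f v) = fmor G X Y f (\<alpha> X v)"
  shows "nat_trans F G \<alpha>"
proof
  fix X Y :: "'a set" and f assume XY: "X \<in> Sets" "Y \<in> Sets" "f \<in> X \<rightarrow>\<^sub>E Y"
  show "compose (fobj F X) (\<alpha> Y) (fmor F X Y f) = compose (fobj F X) (fmor G X Y f) (\<alpha> X)"
    using assms(3)[OF XY] unfolding compose_def by (intro restrict_ext) auto
qed (use assms(1,2) in \<open>auto simp: PiE_iff\<close>)

lemma fmor_apply:
  assumes "set_functor F" "X \<in> Sets" "Y \<in> Sets" "f \<in> X \<rightarrow>\<^sub>E Y" "v \<in> fobj F X"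
  shows "fmor F X Y f v \<in> fobj F Y"
  using set_functor.mor_closed[OF assms(1-4)] assms(5) by blast

lemma fmor_compose:
  assumes "set_functor F" "X \<in> Sets" "Y \<in> Sets" "Z \<in> Sets" "f \<in> X \<rightarrow>\<^sub>E Y" "g \<in> Y \<rightarrow>\<^sub>E Z"
    and "v \<in> fobj F X"
  shows "fmor F X Z (compose X g f) v = fmor F Y Z g (fmor F X Y f v)"
  using set_functor.mor_comp[OF assms(1-6)] assms(7) by (simp add: compose_eq)

lemma comp_functor_simps [simp]:
  "fobj (G \<circ>\<^sub>F F) X = fobj G (fobj F X)"
  "fmor (G \<circ>\<^sub>F F) X Y f = fmor G (fobj F X) (fobj F Y) (fmor F X Y f)"
  by (simp_all add: comp_functor_def)

lemma id_functor_simps [simp]: "fobj id_functor X = X" "fmor id_functor X Y f = f"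
  by (simp_all add: id_functor_def)

lemma compose_PiE: "f \<in> X \<rightarrow>\<^sub>E Y \<Longrightarrow> g \<in> Y \<rightarrow>\<^sub>E Z \<Longrightarrow> compose X g f \<in> X \<rightarrow>\<^sub>E Z"
  by (auto simp: compose_def PiE_iff)

lemma nt_eqD:
  assumes "nt_eq (vcomp F \<beta> \<alpha>) \<theta>" "X \<in> Sets" "v \<in> fobj F X"
  shows "\<beta> X (\<alpha> X v) = \<theta> X v"
proof -
  have "compose (fobj F X) (\<beta> X) (\<alpha> X) = \<theta> X"
    using assms(1,2) unfolding nt_eq_def vcomp_def by blast
  then show ?thesis
    using compose_eq[OF assms(3)] by metis
qed

lemma nt_eqI:
  assumes "\<And>X. X \<in> Sets \<Longrightarrow> \<alpha> X \<in> extensional (fobj F X)"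
    and "\<And>X. X \<in> Sets \<Longrightarrow> \<beta> X \<in> extensional (fobj F X)"
    and "\<And>X v. X \<in> Sets \<Longrightarrow> v \<in> fobj F X \<Longrightarrow> \<alpha> X v = \<beta> X v"
  shows "nt_eq \<alpha> \<beta>"
  unfolding nt_eq_def using assms extensionalityI by blast

lemma vcomp_extensional [simp]: "vcomp F \<beta> \<alpha> X \<in> extensional (fobj F X)"
  by (simp add: vcomp_def)

lemma vcomp_apply [simp]: "v \<in> fobj F X \<Longrightarrow> vcomp F \<beta> \<alpha> X v = \<beta> X (\<alpha> X v)"
  by (simp add: vcomp_def compose_eq)

lemma nat_trans_extensional: "nat_trans F G \<alpha> \<Longrightarrow> X \<in> Sets \<Longrightarrow> \<alpha> X \<in> extensional (fobj F X)"
  using nat_trans.component by (fastforce simp: PiE_def)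


subsection \<open>Polynomial functors\<close>

text \<open>\<open>V\<close> carries only the type of the universe. The instances below are the
  universe \<open>U\<close> with its sets \<open>El A\<close>, and the objects of a category with
  the sets of morphisms out of them.\<close>

locale small_family =
  fixes V :: "'v itself" and I :: "'i set" and B :: "'i \<Rightarrow> 'b set"
  assumes universe: "set_universe TYPE('v)"
    and small_index: "small TYPE('v) I"
    and small_fibre: "i \<in> I \<Longrightarrow> small TYPE('v) (B i)"
begin

abbreviation code :: "'i \<times> ('b \<Rightarrow> 'v) \<Rightarrow> 'v" where
  "code \<equiv> poly_code I B"

text \<open>One injection must serve every \<open>X\<close> at once, so \<open>poly_dom\<close>
  consists of functions into all of \<open>UNIV\<close> and need not be small. It is a small sum of
  sets of cardinality at most that of the universe, which suffices for an injection into
  \<open>'v\<close>.\<close>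

lemma inj_on_code: "inj_on code (poly_dom I B)"
proof -
  have "(card_of (poly_dom I B :: ('i \<times> ('b \<Rightarrow> 'v)) set), card_of (UNIV :: 'v set)) \<in> ordLeq"
    unfolding poly_dom_def
    using universe small_index small_fibre card_PiE_small_le[OF universe]
    by (intro card_of_Sigma_ordLeq_infinite) (auto simp: set_universe_def small_def intro: ordLess_imp_ordLeq)
  then obtain e :: "'i \<times> ('b \<Rightarrow> 'v) \<Rightarrow> 'v" where "inj_on e (poly_dom I B)"
    using card_of_ordLeq[of "poly_dom I B :: ('i \<times> ('b \<Rightarrow> 'v)) set" "UNIV :: 'v set"] by blast
  then show ?thesis
    unfolding poly_code_def by (rule someI[of "\<lambda>e. inj_on e (poly_dom I B)"])
qed

lemma poly_decode_code:
  assumes "i \<in> I" "x \<in> B i \<rightarrow>\<^sub>E X"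
  shows "poly_decode I B (code (i, x)) = (i, x)"
  unfolding poly_decode_def
  by (rule inv_into_f_f[OF inj_on_code]) (use assms in \<open>auto simp: poly_dom_def PiE_iff\<close>)

text \<open>The targets \<open>X\<close> and \<open>Y\<close> may differ because both elements lie
  in the common domain \<open>poly_dom I B\<close>.\<close>

lemma code_eq_iff:
  assumes "i \<in> I" "x \<in> B i \<rightarrow>\<^sub>E X" "j \<in> I" "y \<in> B j \<rightarrow>\<^sub>E Y"
  shows "code (i, x) = code (j, y) \<longleftrightarrow> i = j \<and> x = y"
  using poly_decode_code[OF assms(1,2)] poly_decode_code[OF assms(3,4)] by (metis prod.inject)

lemma code_in_poly: "i \<in> I \<Longrightarrow> x \<in> B i \<rightarrow>\<^sub>E X \<Longrightarrow> code (i, x) \<in> fobj (poly I B) X"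
  by (simp add: poly_def poly_obj_def)

lemma poly_cases:
  assumes "v \<in> fobj (poly I B) X"
  obtains i x where "i \<in> I" "x \<in> B i \<rightarrow>\<^sub>E X" "v = code (i, x)"
  using assms by (auto simp: poly_def poly_obj_def)

lemma fmor_poly_code:
  assumes "i \<in> I" "x \<in> B i \<rightarrow>\<^sub>E X"
  shows "fmor (poly I B) X Y f (code (i, x)) = code (i, compose (B i) f x)"
  using code_in_poly[OF assms] poly_decode_code[OF assms] by (simp add: poly_def)

lemma fmor_poly_extensional: "fmor (poly I B) X Y f \<in> extensional (fobj (poly I B) X)"
  by (simp add: poly_def)

sublocale poly_functor: set_functor "poly I B :: 'v setfun"
proof
  fix X :: "'v set" assume "X \<in> Sets"
  then have "small TYPE('v) X"
    unfolding Sets_def by blast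
  then have "small TYPE('v) (SIGMA i:I. B i \<rightarrow>\<^sub>E X)"
    by (intro small_Sigma[OF universe small_index] small_PiE[OF universe small_fibre])
  then show "fobj (poly I B) X \<in> Sets"
    by (simp add: Sets_def poly_def poly_obj_def small_image)
next
  fix X Y :: "'v set" and f assume f: "f \<in> X \<rightarrow>\<^sub>E Y"
  have "fmor (poly I B) X Y f v \<in> fobj (poly I B) Y" if "v \<in> fobj (poly I B) X" for v
    using that
  proof (rule poly_cases)
    fix i x assume "i \<in> I" "x \<in> B i \<rightarrow>\<^sub>E X" "v = code (i, x)"
    then show ?thesis
      using code_in_poly compose_PiE[OF _ f] fmor_poly_code by metis
  qed
  then show "fmor (poly I B) X Y f \<in> fobj (poly I B) X \<rightarrow>\<^sub>E fobj (poly I B) Y"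
    by (auto simp: PiE_iff poly_def)
next
  fix X :: "'v set"
  have "fmor (poly I B) X X (\<lambda>x\<in>X. x) v = v" if "v \<in> fobj (poly I B) X" for v
    using that
  proof (rule poly_cases)
    fix i x assume x: "i \<in> I" "x \<in> B i \<rightarrow>\<^sub>E X" "v = code (i, x)"
    then have "compose (B i) (\<lambda>x\<in>X. x) x = x"
      by (intro Id_compose) (auto simp: PiE_def)
    then show ?thesis
      using x fmor_poly_code by metis
  qed
  then show "fmor (poly I B) X X (\<lambda>x\<in>X. x) = (\<lambda>v\<in>fobj (poly I B) X. v)"
    by (intro extensionalityI[OF fmor_poly_extensional]) auto
next
  fix X Y Z :: "'v set" and f g
  assume f: "f \<in> X \<rightarrow>\<^sub>E Y" and g: "g \<in> Y \<rightarrow>\<^sub>E Z"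
  show "fmor (poly I B) X Z (compose X g f)
      = compose (fobj (poly I B) X) (fmor (poly I B) Y Z g) (fmor (poly I B) X Y f)"
  proof (rule extensionalityI[where A = "fobj (poly I B) X"])
    fix v assume v: "v \<in> fobj (poly I B) X"
    then obtain i x where i: "i \<in> I" "x \<in> B i \<rightarrow>\<^sub>E X" "v = code (i, x)"
      by (rule poly_cases)
    have "compose (B i) (compose X g f) x = compose (B i) g (compose (B i) f x)"
      using i(2) by (auto simp: compose_def intro!: restrict_ext)
    then show "fmor (poly I B) X Z (compose X g f) v
        = compose (fobj (poly I B) X) (fmor (poly I B) Y Z g) (fmor (poly I B) X Y f) v"
      using i v compose_PiE[OF i(2) f] by (simp add: compose_eq fmor_poly_code)
  qed (auto simp: poly_def)
qed

end

subsection \<open>Comonads and Kan extensions\<close>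

lemma set_functor_comp:
  assumes "set_functor G" "set_functor F"
  shows "set_functor (G \<circ>\<^sub>F F)"
proof -
  interpret G: set_functor G by fact
  interpret F: set_functor F by fact
  show ?thesis
    by unfold_locales (simp_all add: G.obj_closed F.obj_closed G.mor_closed F.mor_closed
        G.mor_id F.mor_id F.mor_comp G.mor_comp)
qed

lemma set_functor_id: "set_functor id_functor"
  by unfold_locales simp_all

lemma nat_trans_vcomp:
  assumes F: "set_functor F" and \<alpha>: "nat_trans F G \<alpha>" and \<beta>: "nat_trans G H \<beta>"
  shows "nat_trans F H (vcomp F \<beta> \<alpha>)"
proof (rule nat_transI)
  fix X Y :: "'a set" and f v assume X: "X \<in> Sets" "Y \<in> Sets" "f \<in> X \<rightarrow>\<^sub>E Y" and v: "v \<in> fobj F X"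
  then show "vcomp F \<beta> \<alpha> Y (fmor F X Y f v) = fmor H X Y f (vcomp F \<beta> \<alpha> X v)"
    using fmor_apply[OF F X v] nat_trans_natural[OF \<alpha> X v]
      nat_trans_natural[OF \<beta> X nat_trans_apply[OF \<alpha> X(1) v]] by simp
qed (simp_all add: nat_trans_apply[OF \<alpha>] nat_trans_apply[OF \<beta>])

lemma nat_trans_whisk_right:
  assumes \<alpha>: "nat_trans F G \<alpha>" and K: "set_functor K"
  shows "nat_trans (F \<circ>\<^sub>F K) (G \<circ>\<^sub>F K) (whisk_right \<alpha> K)"
proof -
  interpret K: set_functor K by fact
  show ?thesis
    by (rule nat_transI)
      (simp_all add: whisk_right_def nat_trans_extensional[OF \<alpha>] nat_trans_apply[OF \<alpha>]
        nat_trans_natural[OF \<alpha>] K.obj_closed K.mor_closed)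
qed

lemma nat_trans_whisk_left:
  assumes \<alpha>: "nat_trans F G \<alpha>" and F: "set_functor F" and G: "set_functor G" and K: "set_functor K"
  shows "nat_trans (K \<circ>\<^sub>F F) (K \<circ>\<^sub>F G) (whisk_left K F G \<alpha>)"
proof -
  interpret F: set_functor F by fact
  interpret G: set_functor G by fact
  interpret K: set_functor K by fact
  show ?thesis
  proof
    fix X :: "'a set" assume "X \<in> Sets"
    then show "whisk_left K F G \<alpha> X \<in> fobj (K \<circ>\<^sub>F F) X \<rightarrow>\<^sub>E fobj (K \<circ>\<^sub>F G) X"
      unfolding whisk_left_def comp_functor_simps
      by (intro K.mor_closed F.obj_closed G.obj_closed nat_trans.component[OF \<alpha>])
  next
    fix X Y :: "'a set" and f assume X: "X \<in> Sets" "Y \<in> Sets" "f \<in> X \<rightarrow>\<^sub>E Y"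
    note Fo = F.obj_closed[OF X(1)] F.obj_closed[OF X(2)]
    note Go = G.obj_closed[OF X(1)] G.obj_closed[OF X(2)]
    show "compose (fobj (K \<circ>\<^sub>F F) X) (whisk_left K F G \<alpha> Y) (fmor (K \<circ>\<^sub>F F) X Y f)
        = compose (fobj (K \<circ>\<^sub>F F) X) (fmor (K \<circ>\<^sub>F G) X Y f) (whisk_left K F G \<alpha> X)"
      unfolding whisk_left_def comp_functor_simps
        K.mor_comp[OF Fo Go(2) F.mor_closed[OF X] nat_trans.component[OF \<alpha> X(2)], symmetric]
        K.mor_comp[OF Fo(1) Go nat_trans.component[OF \<alpha> X(1)] G.mor_closed[OF X], symmetric]
        nat_trans.natural[OF \<alpha> X] ..
  qed
qed

text \<open>The universal property compares factorisations of a given \<theta> with a chosen one.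
  With \<theta> the composite of \<sigma> and the unit, both \<sigma> and \<tau> are factorisations
  of \<theta>, hence equal on \<open>Sets\<close>. This is the form in which uniqueness is used: two
  transformations out of \<open>L\<close> agree once they agree on the unit.\<close>

lemma left_kan_unique:
  assumes kan: "is_left_kan q p L \<eta>" and p: "set_functor p" and q: "set_functor q"
    and r: "set_functor r" and \<sigma>: "nat_trans L r \<sigma>" and \<tau>: "nat_trans L r \<tau>"
    and eq: "\<And>X v. X \<in> Sets \<Longrightarrow> v \<in> fobj p X \<Longrightarrow> \<sigma> (fobj q X) (\<eta> X v) = \<tau> (fobj q X) (\<eta> X v)"
    and X: "X \<in> Sets"
  shows "\<sigma> X = \<tau> X"
proof -
  let ?\<theta> = "vcomp p (whisk_right \<sigma> q) \<eta>"
  have "nat_trans p (L \<circ>\<^sub>F q) \<eta>"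
    using kan unfolding is_left_kan_def by blast
  then have "nat_trans p (r \<circ>\<^sub>F q) ?\<theta>"
    using nat_trans_vcomp[OF p _ nat_trans_whisk_right[OF \<sigma> q]] by blast
  then obtain \<rho> where \<rho>:
      "\<And>\<rho>'. nat_trans L r \<rho>' \<Longrightarrow> nt_eq (vcomp p (whisk_right \<rho>' q) \<eta>) ?\<theta> \<Longrightarrow> nt_eq \<rho>' \<rho>"
    using kan r unfolding is_left_kan_def by blast
  have "nt_eq ?\<theta> ?\<theta>"
    by (simp add: nt_eq_def)
  moreover have "nt_eq (vcomp p (whisk_right \<tau> q) \<eta>) ?\<theta>"
    by (rule nt_eqI[where F = p]) (simp_all add: whisk_right_def eq)
  ultimately have "nt_eq \<sigma> \<rho>" "nt_eq \<tau> \<rho>"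
    using \<rho> \<sigma> \<tau> by blast+
  then show ?thesis
    using X unfolding nt_eq_def by auto
qed

section \<open>Isomorphisms of comonads: composition and transport of the laws\<close>

lemma comonad_isomorphicI:
  assumes "nat_trans (func k) (func l) \<alpha>"
    and "\<And>X. X \<in> Sets \<Longrightarrow> bij_betw (\<alpha> X) (fobj (func k) X) (fobj (func l) X)"
    and "\<And>X. X \<in> Sets \<Longrightarrow> counit k X \<in> extensional (fobj (func k) X)"
    and "\<And>X v. X \<in> Sets \<Longrightarrow> v \<in> fobj (func k) X \<Longrightarrow> counit l X (\<alpha> X v) = counit k X v"
    and "\<And>X v. X \<in> Sets \<Longrightarrow> v \<in> fobj (func k) X \<Longrightarrow> comult l X (\<alpha> X v)
      = \<alpha> (fobj (func l) X)
          (fmor (func k) (fobj (func k) X) (fobj (func l) X) (\<alpha> X) (comult k X v))"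
  shows "comonad_isomorphic k l"
  unfolding comonad_isomorphic_def
  by (intro exI[of _ \<alpha>] conjI ballI nt_eqI[where F = "func k"])
    (simp_all add: assms whisk_left_def whisk_right_def)

lemma comonad_isomorphicE:
  assumes "comonad_isomorphic k l"
  obtains \<alpha> where "nat_trans (func k) (func l) \<alpha>"
    and "\<And>X. X \<in> Sets \<Longrightarrow> bij_betw (\<alpha> X) (fobj (func k) X) (fobj (func l) X)"
    and "\<And>X v. X \<in> Sets \<Longrightarrow> v \<in> fobj (func k) X \<Longrightarrow> counit l X (\<alpha> X v) = counit k X v"
    and "\<And>X v. X \<in> Sets \<Longrightarrow> v \<in> fobj (func k) X \<Longrightarrow> comult l X (\<alpha> X v)
      = \<alpha> (fobj (func l) X)
          (fmor (func k) (fobj (func k) X) (fobj (func l) X) (\<alpha> X) (comult k X v))"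
proof -
  obtain \<alpha> where \<alpha>: "nat_trans (func k) (func l) \<alpha>"
      "\<forall>X\<in>Sets. bij_betw (\<alpha> X) (fobj (func k) X) (fobj (func l) X)"
    and counit: "nt_eq (vcomp (func k) (counit l) \<alpha>) (counit k)"
    and comult: "nt_eq (vcomp (func k) (comult l) \<alpha>)
       (vcomp (func k) (whisk_right \<alpha> (func l))
         (vcomp (func k) (whisk_left (func k) (func k) (func l) \<alpha>) (comult k)))"
    using assms unfolding comonad_isomorphic_def by blast
  show thesis
    by (rule that[OF \<alpha>(1)])
      (use \<alpha>(2) nt_eqD[OF counit] nt_eqD[OF comult] in
        \<open>simp_all add: whisk_left_def whisk_right_def\<close>)
qed

text \<open>Comultiplications are respected by the composite because \<alpha> is natural at the map
  \<open>\<beta> X\<close>: this puts the actions of \<alpha> and \<beta> on the inner level side by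
  side under \<open>func k\<close>, where functoriality merges them.\<close>

lemma comonad_isomorphic_trans:
  assumes k: "set_functor (func k)" "nat_trans (func k) id_functor (counit k)"
      "nat_trans (func k) (func k \<circ>\<^sub>F func k) (comult k)"
    and l: "set_functor (func l)" and m: "set_functor (func m)"
    and "comonad_isomorphic k l" "comonad_isomorphic l m"
  shows "comonad_isomorphic k m"
proof -
  let ?K = "func k" and ?L = "func l" and ?M = "func m"
  interpret K: set_functor ?K by fact
  interpret L: set_functor ?L by fact
  interpret M: set_functor ?M by fact
  obtain \<alpha> where \<alpha>: "nat_trans ?K ?L \<alpha>"
    and \<alpha>_bij: "\<And>X. X \<in> Sets \<Longrightarrow> bij_betw (\<alpha> X) (fobj ?K X) (fobj ?L X)"
    and \<alpha>_counit: "\<And>X v. X \<in> Sets \<Longrightarrow> v \<in> fobj ?K X \<Longrightarrow> counit l X (\<alpha> X v) = counit k X v"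
    and \<alpha>_comult: "\<And>X v. X \<in> Sets \<Longrightarrow> v \<in> fobj ?K X \<Longrightarrow> comult l X (\<alpha> X v)
      = \<alpha> (fobj ?L X) (fmor ?K (fobj ?K X) (fobj ?L X) (\<alpha> X) (comult k X v))"
    using assms(6) by (rule comonad_isomorphicE) blast
  obtain \<beta> where \<beta>: "nat_trans ?L ?M \<beta>"
    and \<beta>_bij: "\<And>X. X \<in> Sets \<Longrightarrow> bij_betw (\<beta> X) (fobj ?L X) (fobj ?M X)"
    and \<beta>_counit: "\<And>X v. X \<in> Sets \<Longrightarrow> v \<in> fobj ?L X \<Longrightarrow> counit m X (\<beta> X v) = counit l X v"
    and \<beta>_comult: "\<And>X v. X \<in> Sets \<Longrightarrow> v \<in> fobj ?L X \<Longrightarrow> comult m X (\<beta> X v)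
      = \<beta> (fobj ?M X) (fmor ?L (fobj ?L X) (fobj ?M X) (\<beta> X) (comult l X v))"
    using assms(7) by (rule comonad_isomorphicE) blast
  show ?thesis
  proof (rule comonad_isomorphicI[where \<alpha> = "vcomp ?K \<beta> \<alpha>"])
    show "nat_trans ?K ?M (vcomp ?K \<beta> \<alpha>)"
      by (rule nat_trans_vcomp[OF k(1) \<alpha> \<beta>])
    show "bij_betw (vcomp ?K \<beta> \<alpha> X) (fobj ?K X) (fobj ?M X)" if "X \<in> Sets" for X
      unfolding vcomp_def using bij_betw_compose[OF \<alpha>_bij \<beta>_bij] that by blast
    show "counit k X \<in> extensional (fobj ?K X)" if "X \<in> Sets" for X
      by (rule nat_trans_extensional[OF k(2) that])
    show "counit m X (vcomp ?K \<beta> \<alpha> X v) = counit k X v" if "X \<in> Sets" "v \<in> fobj ?K X" for X v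
      using that by (simp add: \<alpha>_counit \<beta>_counit nat_trans_apply[OF \<alpha>])
  next
    fix X v assume X: "X \<in> Sets" and v: "v \<in> fobj ?K X"
    note o = K.obj_closed[OF X] L.obj_closed[OF X] M.obj_closed[OF X]
    note \<alpha>X = nat_trans.component[OF \<alpha> X] and \<beta>X = nat_trans.component[OF \<beta> X]
    define w where "w = comult k X v"
    have w: "w \<in> fobj ?K (fobj ?K X)"
      using nat_trans_apply[OF k(3) X v] by (simp add: w_def)
    have \<alpha>w: "fmor ?K (fobj ?K X) (fobj ?L X) (\<alpha> X) w \<in> fobj ?K (fobj ?L X)"
      by (rule fmor_apply[OF k(1) o(1,2) \<alpha>X w])
    have "comult m X (\<beta> X (\<alpha> X v)) = \<beta> (fobj ?M X) (fmor ?L (fobj ?L X) (fobj ?M X) (\<beta> X)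
        (\<alpha> (fobj ?L X) (fmor ?K (fobj ?K X) (fobj ?L X) (\<alpha> X) w)))"
      using X v by (simp add: \<alpha>_comult \<beta>_comult nat_trans_apply[OF \<alpha>] w_def)
    also have "\<dots> = \<beta> (fobj ?M X) (\<alpha> (fobj ?M X) (fmor ?K (fobj ?L X) (fobj ?M X) (\<beta> X)
        (fmor ?K (fobj ?K X) (fobj ?L X) (\<alpha> X) w)))"
      using nat_trans_natural[OF \<alpha> o(2,3) \<beta>X \<alpha>w] by simp
    also have "\<dots> = \<beta> (fobj ?M X) (\<alpha> (fobj ?M X)
        (fmor ?K (fobj ?K X) (fobj ?M X) (vcomp ?K \<beta> \<alpha> X) w))"
      unfolding vcomp_def using fmor_compose[OF k(1) o \<alpha>X \<beta>X w] by simp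
    finally show "comult m X (vcomp ?K \<beta> \<alpha> X v) = vcomp ?K \<beta> \<alpha> (fobj ?M X)
        (fmor ?K (fobj ?K X) (fobj ?M X) (vcomp ?K \<beta> \<alpha> X) (comult k X v))"
      using v fmor_apply[OF k(1) o(1,3) compose_PiE[OF \<alpha>X \<beta>X] w]
      \<comment> \<open>The composite occurs here both at \<open>X\<close>, as the map on which
        \<open>func k\<close> acts, and at \<open>fobj ?M X\<close>, applied to an element. Only the
        first has to become a \<open>compose\<close>.\<close>
      by (simp add: w_def vcomp_def[of ?K \<beta> \<alpha> X] vcomp_apply[of _ ?K "fobj ?M X"] compose_eq)
  qed
qed

text \<open>Every element of \<open>fobj (func l) X\<close> has the form
  \<open>\<alpha> X v\<close>, so each law for \<open>l\<close> reduces to the same law for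
  \<open>k\<close> at \<open>v\<close>, carried across by naturality of \<alpha> and of the
  structure of \<open>k\<close>. It supplies the comonad laws for an arbitrary extension.\<close>

lemma comonad_transport:
  assumes "comonad k" and iso: "comonad_isomorphic k l" and L: "set_functor (func l)"
    and counit_l: "nat_trans (func l) id_functor (counit l)"
    and comult_l: "nat_trans (func l) (func l \<circ>\<^sub>F func l) (comult l)"
  shows "comonad l"
proof -
  let ?K = "func k" and ?L = "func l"
  interpret k: comonad k by fact
  note K = k.func_functor
  interpret K: set_functor ?K by (rule K)
  interpret L: set_functor ?L by fact
  obtain \<alpha> where \<alpha>: "nat_trans ?K ?L \<alpha>"
    and bij: "\<And>X. X \<in> Sets \<Longrightarrow> bij_betw (\<alpha> X) (fobj ?K X) (fobj ?L X)"
    and counit: "\<And>X v. X \<in> Sets \<Longrightarrow> v \<in> fobj ?K X \<Longrightarrow> counit l X (\<alpha> X v) = counit k X v"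
    and comult: "\<And>X v. X \<in> Sets \<Longrightarrow> v \<in> fobj ?K X \<Longrightarrow> comult l X (\<alpha> X v)
      = \<alpha> (fobj ?L X) (fmor ?K (fobj ?K X) (fobj ?L X) (\<alpha> X) (comult k X v))"
    using iso by (rule comonad_isomorphicE) blast
  have laws: "counit l (fobj ?L X) (comult l X u) = u
      \<and> fmor ?L (fobj ?L X) X (counit l X) (comult l X u) = u
      \<and> comult l (fobj ?L X) (comult l X u)
        = fmor ?L (fobj ?L X) (fobj ?L (fobj ?L X)) (comult l X) (comult l X u)"
    if X: "X \<in> Sets" and u: "u \<in> fobj ?L X" for X u
  proof -
    obtain v where v: "v \<in> fobj ?K X" and u_def: "u = \<alpha> X v"
      using bij[OF X] u unfolding bij_betw_def by blast
    let ?KX = "fobj ?K X" and ?LX = "fobj ?L X"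
    have o: "?KX \<in> Sets" "?LX \<in> Sets"
      using X K.obj_closed L.obj_closed by blast+
    have oo: "fobj ?K ?KX \<in> Sets" "fobj ?K ?LX \<in> Sets" "fobj ?L ?LX \<in> Sets"
      using o K.obj_closed L.obj_closed by blast+
    note \<alpha>X = nat_trans.component[OF \<alpha> X] and \<alpha>LX = nat_trans.component[OF \<alpha> o(2)]
    have \<delta>X: "comult k X \<in> ?KX \<rightarrow>\<^sub>E fobj ?K ?KX"
      using nat_trans.component[OF k.comult_nat X] by simp
    have \<delta>LX: "comult l X \<in> ?LX \<rightarrow>\<^sub>E fobj ?L ?LX"
      using nat_trans.component[OF comult_l X] by simp
    have \<epsilon>LX: "counit l X \<in> ?LX \<rightarrow>\<^sub>E X"
      using nat_trans.component[OF counit_l X] by simp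
    define w where "w = comult k X v"
    have w: "w \<in> fobj ?K ?KX"
      using \<delta>X v unfolding w_def by blast
    \<comment> \<open>\<open>z\<close> is the comultiplication of \<open>k\<close> at
      \<open>v\<close> with only the inner level moved to \<open>?L\<close>; applying
      \<open>\<alpha> ?LX\<close> moves the outer level and yields
      \<open>comult l X u\<close>.\<close>
    define z where "z = fmor ?K ?KX ?LX (\<alpha> X) w"
    have z: "z \<in> fobj ?K ?LX"
      unfolding z_def by (rule fmor_apply[OF K o \<alpha>X w])
    have \<delta>u: "comult l X u = \<alpha> ?LX z"
      using comult[OF X v] unfolding u_def z_def w_def .
    have "counit l ?LX (comult l X u) = counit k ?LX z"
      using \<delta>u counit[OF o(2) z] by simp
    also have "\<dots> = \<alpha> X (counit k ?KX w)"
      using nat_trans_natural[OF k.counit_nat o \<alpha>X w] by (simp add: z_def)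
    also have "counit k ?KX w = v"
      using nt_eqD[OF k.counit_left X v] v by (simp add: whisk_right_def w_def nt_id_def)
    finally have left: "counit l ?LX (comult l X u) = u"
      by (simp add: u_def)
    have "fmor ?L ?LX X (counit l X) (comult l X u) = \<alpha> X (fmor ?K ?LX X (counit l X) z)"
      using \<delta>u nat_trans_natural[OF \<alpha> o(2) X \<epsilon>LX z] by simp
    also have "fmor ?K ?LX X (counit l X) z = fmor ?K ?KX X (compose ?KX (counit l X) (\<alpha> X)) w"
      unfolding z_def by (rule fmor_compose[OF K o X \<alpha>X \<epsilon>LX w, symmetric])
    also have "compose ?KX (counit l X) (\<alpha> X) = counit k X"
      using counit[OF X] nat_trans_extensional[OF k.counit_nat X]
      by (intro extensionalityI[where A = ?KX]) (simp_all add: compose_eq)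
    also have "fmor ?K ?KX X (counit k X) w = v"
      using nt_eqD[OF k.counit_right X v] v by (simp add: whisk_left_def w_def nt_id_def)
    finally have right: "fmor ?L ?LX X (counit l X) (comult l X u) = u"
      by (simp add: u_def)
    have \<delta>w: "comult k ?KX w \<in> fobj ?K (fobj ?K ?KX)"
      using nat_trans_apply[OF k.comult_nat o(1) w] by simp
    have K\<alpha>: "fmor ?K ?KX ?LX (\<alpha> X) \<in> fobj ?K ?KX \<rightarrow>\<^sub>E fobj ?K ?LX"
      by (rule K.mor_closed[OF o \<alpha>X])
    have "comult l ?LX (comult l X u)
        = \<alpha> (fobj ?L ?LX) (fmor ?K (fobj ?K ?LX) (fobj ?L ?LX) (\<alpha> ?LX) (comult k ?LX z))"
      using \<delta>u comult[OF o(2) z] by simp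
    also have "comult k ?LX z
        = fmor ?K (fobj ?K ?KX) (fobj ?K ?LX) (fmor ?K ?KX ?LX (\<alpha> X)) (comult k ?KX w)"
      using nat_trans_natural[OF k.comult_nat o \<alpha>X w] by (simp add: z_def)
    also have "comult k ?KX w = fmor ?K ?KX (fobj ?K ?KX) (comult k X) w"
      using nt_eqD[OF k.coassoc X v] v by (simp add: whisk_left_def whisk_right_def w_def)
    also have "fmor ?K (fobj ?K ?LX) (fobj ?L ?LX) (\<alpha> ?LX)
          (fmor ?K (fobj ?K ?KX) (fobj ?K ?LX) (fmor ?K ?KX ?LX (\<alpha> X))
            (fmor ?K ?KX (fobj ?K ?KX) (comult k X) w))
        = fmor ?K ?KX (fobj ?L ?LX)
            (compose ?KX (\<alpha> ?LX) (compose ?KX (fmor ?K ?KX ?LX (\<alpha> X)) (comult k X))) w"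
      using fmor_compose[OF K o(1) oo(1,2) \<delta>X K\<alpha> w]
        fmor_compose[OF K o(1) oo(2,3) compose_PiE[OF \<delta>X K\<alpha>] \<alpha>LX w] by simp
    \<comment> \<open>This is compatibility of \<alpha> with the comultiplications, read as an
      equality of maps out of \<open>?KX\<close>. It can be applied under \<open>?K\<close> because
      the three maps were merged into one.\<close>
    also have "compose ?KX (\<alpha> ?LX) (compose ?KX (fmor ?K ?KX ?LX (\<alpha> X)) (comult k X))
        = compose ?KX (comult l X) (\<alpha> X)"
      using comult[OF X]
      by (intro extensionalityI[where A = ?KX]) (simp_all add: compose_eq)
    also have "fmor ?K ?KX (fobj ?L ?LX) (compose ?KX (comult l X) (\<alpha> X)) w
        = fmor ?K ?LX (fobj ?L ?LX) (comult l X) z"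
      unfolding z_def by (rule fmor_compose[OF K o oo(3) \<alpha>X \<delta>LX w])
    also have "\<alpha> (fobj ?L ?LX) (fmor ?K ?LX (fobj ?L ?LX) (comult l X) z)
        = fmor ?L ?LX (fobj ?L ?LX) (comult l X) (comult l X u)"
      using \<delta>u nat_trans_natural[OF \<alpha> o(2) oo(3) \<delta>LX z] by simp
    finally show ?thesis
      using left right by blast
  qed
  show ?thesis
  proof (rule comonad.intro)
    show "nt_eq (vcomp ?L (whisk_right (counit l) ?L) (comult l)) (nt_id ?L)"
      by (rule nt_eqI[where F = ?L]) (simp_all add: nt_id_def whisk_right_def laws)
    show "nt_eq (vcomp ?L (whisk_left ?L ?L id_functor (counit l)) (comult l)) (nt_id ?L)"
      by (rule nt_eqI[where F = ?L]) (simp_all add: nt_id_def whisk_left_def laws)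
    show "nt_eq (vcomp ?L (whisk_right (comult l) ?L) (comult l))
        (vcomp ?L (whisk_left ?L ?L (?L \<circ>\<^sub>F ?L) (comult l)) (comult l))"
      by (rule nt_eqI[where F = ?L]) (simp_all add: whisk_left_def whisk_right_def laws)
  qed (fact L counit_l comult_l)+
qed

section \<open>Uniqueness of the comonad carried by a left Kan extension\<close>

lemma is_lan_comonadE:
  assumes "is_lan_comonad p k l"
  obtains \<eta> where "is_left_kan p (p \<circ>\<^sub>F func k) (func l) \<eta>"
    and "set_functor (func l)"
    and "nat_trans (p \<circ>\<^sub>F func k) (func l \<circ>\<^sub>F p) \<eta>"
    and "nat_trans (func l) id_functor (counit l)"
    and "nat_trans (func l) (func l \<circ>\<^sub>F func l) (comult l)"
    and "\<And>X v. X \<in> Sets \<Longrightarrow> v \<in> fobj p (fobj (func k) X) \<Longrightarrow> counit l (fobj p X) (\<eta> X v)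
      = fmor p (fobj (func k) X) X (counit k X) v"
    and "\<And>X v. X \<in> Sets \<Longrightarrow> v \<in> fobj p (fobj (func k) X) \<Longrightarrow> comult l (fobj p X) (\<eta> X v)
      = fmor (func l) (fobj p (fobj (func k) X)) (fobj (func l) (fobj p X)) (\<eta> X)
          (\<eta> (fobj (func k) X)
            (fmor p (fobj (func k) X) (fobj (func k) (fobj (func k) X)) (comult k X) v))"
proof -
  let ?K = "func k" and ?L = "func l"
  obtain \<eta> where \<eta>: "is_left_kan p (p \<circ>\<^sub>F ?K) ?L \<eta>"
    and nat: "nat_trans ?L id_functor (counit l)" "nat_trans ?L (?L \<circ>\<^sub>F ?L) (comult l)"
    and counit: "nt_eq (vcomp (p \<circ>\<^sub>F ?K) (whisk_right (counit l) p) \<eta>)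
       (whisk_left p ?K id_functor (counit k))"
    and comult: "nt_eq (vcomp (p \<circ>\<^sub>F ?K) (whisk_right (comult l) p) \<eta>)
       (vcomp (p \<circ>\<^sub>F ?K) (whisk_left ?L (p \<circ>\<^sub>F ?K) (?L \<circ>\<^sub>F p) \<eta>)
         (vcomp (p \<circ>\<^sub>F ?K) (whisk_right \<eta> ?K) (whisk_left p ?K (?K \<circ>\<^sub>F ?K) (comult k))))"
    using assms unfolding is_lan_comonad_def Let_def by blast
  have L: "set_functor ?L" and \<eta>_nat: "nat_trans (p \<circ>\<^sub>F ?K) (?L \<circ>\<^sub>F p) \<eta>"
    using \<eta> unfolding is_left_kan_def by blast+
  show thesis
    by (rule that[OF \<eta> L \<eta>_nat nat])
      (use nt_eqD[OF counit] nt_eqD[OF comult] in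
        \<open>simp_all add: whisk_left_def whisk_right_def\<close>)
qed

text \<open>Factoring each unit through the other extension gives \<sigma> and \<tau>. Their
  composites agree with the identities on the units, so they are mutually inverse. Preservation of
  counit and comultiplication by \<sigma> is again an equality of transformations out of
  \<open>func l\<close>, hence it is enough to check it on \<eta>, where both structures are
  prescribed by \<open>k\<close>.\<close>

lemma lan_comonad_unique:
  assumes p: "set_functor p" and k: "comonad k"
    and "is_lan_comonad p k l" "is_lan_comonad p k m"
  shows "comonad_isomorphic l m"
proof -
  let ?K = "func k" and ?L = "func l" and ?M = "func m"
  interpret k: comonad k by fact
  note K = k.func_functor
  note pK = set_functor_comp[OF p K]
  interpret p: set_functor p by (rule p)
  interpret K: set_functor ?K by (rule K)
  obtain \<eta> where \<eta>: "is_left_kan p (p \<circ>\<^sub>F ?K) ?L \<eta>" and L: "set_functor ?L"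
    and \<eta>_nat: "nat_trans (p \<circ>\<^sub>F ?K) (?L \<circ>\<^sub>F p) \<eta>"
    and \<epsilon>: "nat_trans ?L id_functor (counit l)" and \<delta>: "nat_trans ?L (?L \<circ>\<^sub>F ?L) (comult l)"
    and \<epsilon>\<eta>: "\<And>X v. X \<in> Sets \<Longrightarrow> v \<in> fobj p (fobj ?K X) \<Longrightarrow> counit l (fobj p X) (\<eta> X v)
      = fmor p (fobj ?K X) X (counit k X) v"
    and \<delta>\<eta>: "\<And>X v. X \<in> Sets \<Longrightarrow> v \<in> fobj p (fobj ?K X) \<Longrightarrow> comult l (fobj p X) (\<eta> X v)
      = fmor ?L (fobj p (fobj ?K X)) (fobj ?L (fobj p X)) (\<eta> X)
          (\<eta> (fobj ?K X) (fmor p (fobj ?K X) (fobj ?K (fobj ?K X)) (comult k X) v))"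
    using assms(3) by (rule is_lan_comonadE) blast
  obtain \<eta>' where \<eta>': "is_left_kan p (p \<circ>\<^sub>F ?K) ?M \<eta>'" and M: "set_functor ?M"
    and \<eta>'_nat: "nat_trans (p \<circ>\<^sub>F ?K) (?M \<circ>\<^sub>F p) \<eta>'"
    and \<epsilon>': "nat_trans ?M id_functor (counit m)" and \<delta>': "nat_trans ?M (?M \<circ>\<^sub>F ?M) (comult m)"
    and \<epsilon>\<eta>': "\<And>X v. X \<in> Sets \<Longrightarrow> v \<in> fobj p (fobj ?K X) \<Longrightarrow> counit m (fobj p X) (\<eta>' X v)
      = fmor p (fobj ?K X) X (counit k X) v"
    and \<delta>\<eta>': "\<And>X v. X \<in> Sets \<Longrightarrow> v \<in> fobj p (fobj ?K X) \<Longrightarrow> comult m (fobj p X) (\<eta>' X v)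
      = fmor ?M (fobj p (fobj ?K X)) (fobj ?M (fobj p X)) (\<eta>' X)
          (\<eta>' (fobj ?K X) (fmor p (fobj ?K X) (fobj ?K (fobj ?K X)) (comult k X) v))"
    using assms(4) by (rule is_lan_comonadE) blast
  interpret L: set_functor ?L by (rule L)
  interpret M: set_functor ?M by (rule M)
  obtain \<sigma> where \<sigma>: "nat_trans ?L ?M \<sigma>" and "nt_eq (vcomp (p \<circ>\<^sub>F ?K) (whisk_right \<sigma> p) \<eta>) \<eta>'"
    using \<eta> M \<eta>'_nat unfolding is_left_kan_def by blast
  then have \<sigma>\<eta>: "\<sigma> (fobj p X) (\<eta> X v) = \<eta>' X v" if "X \<in> Sets" "v \<in> fobj p (fobj ?K X)" for X v
    using nt_eqD that by (fastforce simp: whisk_right_def)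
  obtain \<tau> where \<tau>: "nat_trans ?M ?L \<tau>" and "nt_eq (vcomp (p \<circ>\<^sub>F ?K) (whisk_right \<tau> p) \<eta>') \<eta>"
    using \<eta>' L \<eta>_nat unfolding is_left_kan_def by blast
  then have \<tau>\<eta>: "\<tau> (fobj p X) (\<eta>' X v) = \<eta> X v" if "X \<in> Sets" "v \<in> fobj p (fobj ?K X)" for X v
    using nt_eqD that by (fastforce simp: whisk_right_def)
  have \<eta>_app: "\<eta> X v \<in> fobj ?L (fobj p X)" if "X \<in> Sets" "v \<in> fobj p (fobj ?K X)" for X v
    using nat_trans_apply[OF \<eta>_nat] that by simp
  have \<eta>'_app: "\<eta>' X v \<in> fobj ?M (fobj p X)" if "X \<in> Sets" "v \<in> fobj p (fobj ?K X)" for X v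
    using nat_trans_apply[OF \<eta>'_nat] that by simp
  have nt_id: "nat_trans F F (nt_id F)" if "set_functor F" for F :: "'a setfun"
    by (rule nat_transI) (simp_all add: nt_id_def fmor_apply[OF that])
  have \<tau>\<sigma>: "\<tau> X (\<sigma> X v) = v" if "X \<in> Sets" "v \<in> fobj ?L X" for X v
  proof -
    have eq: "vcomp ?L \<tau> \<sigma> X = nt_id ?L X"
      by (rule left_kan_unique[OF \<eta> pK p L nat_trans_vcomp[OF L \<sigma> \<tau>] nt_id[OF L] _ that(1)])
        (simp add: nt_id_def \<eta>_app \<sigma>\<eta> \<tau>\<eta>)
    show ?thesis
      using fun_cong[OF eq, of v] that(2) by (simp add: nt_id_def)
  qed
  have \<sigma>\<tau>: "\<sigma> X (\<tau> X v) = v" if "X \<in> Sets" "v \<in> fobj ?M X" for X v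
  proof -
    have eq: "vcomp ?M \<sigma> \<tau> X = nt_id ?M X"
      by (rule left_kan_unique[OF \<eta>' pK p M nat_trans_vcomp[OF M \<tau> \<sigma>] nt_id[OF M] _ that(1)])
        (simp add: nt_id_def \<eta>'_app \<sigma>\<eta> \<tau>\<eta>)
    show ?thesis
      using fun_cong[OF eq, of v] that(2) by (simp add: nt_id_def)
  qed
  show ?thesis
  proof (rule comonad_isomorphicI[OF \<sigma>])
    fix X :: "'a set" assume X: "X \<in> Sets"
    show "bij_betw (\<sigma> X) (fobj ?L X) (fobj ?M X)"
      by (rule bij_betwI[where g = "\<tau> X"])
        (use X nat_trans_apply[OF \<sigma>] nat_trans_apply[OF \<tau>] \<tau>\<sigma> \<sigma>\<tau> in auto)
    show "counit l X \<in> extensional (fobj ?L X)"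
      by (rule nat_trans_extensional[OF \<epsilon> X])
    fix v assume v: "v \<in> fobj ?L X"
    have \<epsilon>\<sigma>: "vcomp ?L (counit m) \<sigma> X = counit l X"
      by (rule left_kan_unique[OF \<eta> pK p set_functor_id nat_trans_vcomp[OF L \<sigma> \<epsilon>'] \<epsilon> _ X])
        (simp add: \<eta>_app \<sigma>\<eta> \<epsilon>\<eta> \<epsilon>\<eta>')
    show "counit m X (\<sigma> X v) = counit l X v"
      using fun_cong[OF \<epsilon>\<sigma>, of v] v by simp
    \<comment> \<open>The horizontal composite of \<sigma> with itself, taken first on the inner and
      then on the outer copy of \<open>?L\<close>.\<close>
    let ?\<sigma>\<sigma> = "vcomp (?L \<circ>\<^sub>F ?L) (whisk_right \<sigma> ?M) (whisk_left ?L ?L ?M \<sigma>)"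
    have \<sigma>\<sigma>: "nat_trans (?L \<circ>\<^sub>F ?L) (?M \<circ>\<^sub>F ?M) ?\<sigma>\<sigma>"
      by (rule nat_trans_vcomp[OF set_functor_comp[OF L L] nat_trans_whisk_left[OF \<sigma> L M L]
            nat_trans_whisk_right[OF \<sigma> M]])
    have \<delta>\<sigma>: "vcomp ?L (comult m) \<sigma> X = vcomp ?L ?\<sigma>\<sigma> (comult l) X"
    proof (rule left_kan_unique[OF \<eta> pK p set_functor_comp[OF M M] nat_trans_vcomp[OF L \<sigma> \<delta>']
          nat_trans_vcomp[OF L \<delta> \<sigma>\<sigma>] _ X])
      fix Y v assume Y: "Y \<in> Sets" and "v \<in> fobj (p \<circ>\<^sub>F ?K) Y"
      then have v: "v \<in> fobj p (fobj ?K Y)"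
        by simp
      note KY = K.obj_closed[OF Y] and pY = p.obj_closed[OF Y]
      note KKY = K.obj_closed[OF KY] and pKY = p.obj_closed[OF KY]
      note LpY = L.obj_closed[OF pY] and MpY = M.obj_closed[OF pY]
      define w where "w = fmor p (fobj ?K Y) (fobj ?K (fobj ?K Y)) (comult k Y) v"
      have w: "w \<in> fobj p (fobj ?K (fobj ?K Y))"
        using nat_trans.component[OF k.comult_nat Y]
        unfolding w_def by (intro fmor_apply[OF p KY KKY _ v]) simp
      note \<eta>w = \<eta>_app[OF KY w]
      have \<eta>Y: "\<eta> Y \<in> fobj p (fobj ?K Y) \<rightarrow>\<^sub>E fobj ?L (fobj p Y)"
        using nat_trans.component[OF \<eta>_nat Y] by simp
      note \<sigma>pY = nat_trans.component[OF \<sigma> pY]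
      have \<sigma>\<eta>Y: "compose (fobj p (fobj ?K Y)) (\<sigma> (fobj p Y)) (\<eta> Y) = \<eta>' Y"
        by (rule extensionalityI[where A = "fobj p (fobj ?K Y)"])
          (use \<sigma>\<eta>[OF Y] nat_trans_extensional[OF \<eta>'_nat Y] in \<open>simp_all add: compose_eq\<close>)
      have \<eta>'Y: "\<eta>' Y \<in> fobj p (fobj ?K Y) \<rightarrow>\<^sub>E fobj ?M (fobj p Y)"
        using nat_trans.component[OF \<eta>'_nat Y] by simp
      have "vcomp ?L (comult m) \<sigma> (fobj p Y) (\<eta> Y v) = comult m (fobj p Y) (\<eta>' Y v)"
        by (simp add: \<eta>_app[OF Y v] \<sigma>\<eta>[OF Y v])
      also have "\<dots> = fmor ?M (fobj p (fobj ?K Y)) (fobj ?M (fobj p Y)) (\<eta>' Y) (\<eta>' (fobj ?K Y) w)"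
        using \<delta>\<eta>'[OF Y v] by (simp add: w_def)
      \<comment> \<open>The inner value of \<open>\<eta>'\<close> is \<sigma> after \<eta>, and
        naturality of \<sigma> at the map \<open>\<eta>' Y\<close> pulls this \<sigma> to the
        outside. In the next step \<open>\<eta>' Y\<close> itself is split in the same way.\<close>
      also have "\<dots> = \<sigma> (fobj ?M (fobj p Y))
          (fmor ?L (fobj p (fobj ?K Y)) (fobj ?M (fobj p Y)) (\<eta>' Y) (\<eta> (fobj ?K Y) w))"
        using nat_trans_natural[OF \<sigma> pKY MpY \<eta>'Y \<eta>w] \<sigma>\<eta>[OF KY w] by simp
      also have "\<dots> = \<sigma> (fobj ?M (fobj p Y))
          (fmor ?L (fobj ?L (fobj p Y)) (fobj ?M (fobj p Y)) (\<sigma> (fobj p Y))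
            (fmor ?L (fobj p (fobj ?K Y)) (fobj ?L (fobj p Y)) (\<eta> Y) (\<eta> (fobj ?K Y) w)))"
        using fmor_compose[OF L pKY LpY MpY \<eta>Y \<sigma>pY \<eta>w] by (simp add: \<sigma>\<eta>Y)
      also have "\<dots> = vcomp ?L ?\<sigma>\<sigma> (comult l) (fobj p Y) (\<eta> Y v)"
        using \<delta>\<eta>[OF Y v] fmor_apply[OF L pKY LpY \<eta>Y \<eta>w] \<eta>_app[OF Y v]
        by (simp add: w_def whisk_left_def whisk_right_def)
      finally show "vcomp ?L (comult m) \<sigma> (fobj p Y) (\<eta> Y v)
          = vcomp ?L ?\<sigma>\<sigma> (comult l) (fobj p Y) (\<eta> Y v)" .
    qed
    show "comult m X (\<sigma> X v) = \<sigma> (fobj ?M X)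
        (fmor ?L (fobj ?L X) (fobj ?M X) (\<sigma> X) (comult l X v))"
      using fun_cong[OF \<delta>\<sigma>, of v] v nat_trans_apply[OF \<delta> X v]
      by (simp add: whisk_left_def whisk_right_def)
  qed
qed

subsection \<open>The comonad of a small category\<close>

locale small_cat = category C
  for V :: "'v itself" and C :: "('o, 'm) cat" +
  assumes set_universe: "set_universe TYPE('v)"
    and small_Ob: "small TYPE('v) (Ob C)"
    and small_Arr: "small TYPE('v) (Arr C)"
begin

sublocale small_family V "Ob C" "out C"
  by unfold_locales (auto simp: set_universe small_Ob out_def intro: small_subset[OF small_Arr])

abbreviation K :: "'v setfun" where
  "K \<equiv> poly (Ob C) (out C)"

text \<open>Restriction of \<open>x\<close> along precomposition with \<open>f\<close>. Together
  \<open>shift\<close> and \<open>splay\<close> are the inner and the outer function in the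
  comultiplication; naming them turns the right unit law and associativity of the category into
  \<open>shift_Ide\<close> and \<open>shift_shift\<close>.\<close>

definition shift :: "('m \<Rightarrow> 'v) \<Rightarrow> 'm \<Rightarrow> 'm \<Rightarrow> 'v" where
  "shift x f = (\<lambda>f'\<in>out C (Cod C f). x (Comp C f' f))"

definition splay :: "'o \<Rightarrow> ('m \<Rightarrow> 'v) \<Rightarrow> 'm \<Rightarrow> 'v" where
  "splay c x = (\<lambda>f\<in>out C c. code (Cod C f, shift x f))"

lemma outD: "f \<in> out C c \<Longrightarrow> f \<in> Arr C" "f \<in> out C c \<Longrightarrow> Dom C f = c"
  by (simp_all add: out_def)

lemma Cod_out: "f \<in> out C c \<Longrightarrow> Cod C f \<in> Ob C"
  by (simp add: out_def cod_ob)

lemma Ide_out: "c \<in> Ob C \<Longrightarrow> Ide C c \<in> out C c"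
  by (simp add: out_def ide_arr dom_ide)

lemma Comp_out:
  assumes "f \<in> out C c" "g \<in> out C (Cod C f)"
  shows "Comp C g f \<in> out C c" "Cod C (Comp C g f) = Cod C g"
  using assms by (auto simp: out_def comp_arr dom_comp cod_comp)

lemma shift_in: "x \<in> out C c \<rightarrow>\<^sub>E X \<Longrightarrow> f \<in> out C c \<Longrightarrow> shift x f \<in> out C (Cod C f) \<rightarrow>\<^sub>E X"
  using Comp_out(1) unfolding shift_def by fastforce

lemma splay_in: "x \<in> out C c \<rightarrow>\<^sub>E X \<Longrightarrow> splay c x \<in> out C c \<rightarrow>\<^sub>E fobj K X"
  using code_in_poly[OF Cod_out shift_in] unfolding splay_def by simp

lemma func_cat_comonad [simp]: "func (cat_comonad C :: 'v comonad_data) = K"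
  by (simp add: cat_comonad_def Let_def)

lemma counit_code:
  assumes "c \<in> Ob C" "x \<in> out C c \<rightarrow>\<^sub>E X"
  shows "counit (cat_comonad C) X (code (c, x)) = x (Ide C c)"
  using code_in_poly[OF assms] poly_decode_code[OF assms]
  by (simp add: cat_comonad_def Let_def poly_def)

lemma comult_code:
  assumes "c \<in> Ob C" "x \<in> out C c \<rightarrow>\<^sub>E X"
  shows "comult (cat_comonad C) X (code (c, x)) = code (c, splay c x)"
  using code_in_poly[OF assms] poly_decode_code[OF assms]
  by (simp add: cat_comonad_def Let_def poly_def splay_def shift_def)

lemma counit_extensional: "counit (cat_comonad C) X \<in> extensional (fobj K X)"
  by (simp add: cat_comonad_def Let_def poly_def)

lemma comult_extensional: "comult (cat_comonad C) X \<in> extensional (fobj K X)"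
  by (simp add: cat_comonad_def Let_def poly_def)

lemma shift_Ide: "c \<in> Ob C \<Longrightarrow> x \<in> out C c \<rightarrow>\<^sub>E X \<Longrightarrow> shift x (Ide C c) = x"
  by (rule extensionalityI[where A = "out C c"])
    (use comp_ide_right in \<open>auto simp: shift_def cod_ide PiE_iff out_def\<close>)

lemma shift_shift:
  assumes "f \<in> out C c" "g \<in> out C (Cod C f)"
  shows "shift (shift x f) g = shift x (Comp C g f)"
  using assms Comp_out comp_assoc unfolding shift_def
  by (auto simp: out_def cod_comp comp_arr dom_comp intro!: restrict_ext)

lemma shift_compose:
  assumes "f \<in> out C c"
  shows "shift (compose (out C c) h x) f = compose (out C (Cod C f)) h (shift x f)"
  using Comp_out(1)[OF assms] by (auto simp: shift_def compose_def intro!: restrict_ext)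

lemma counit_nat: "nat_trans K id_functor (counit (cat_comonad C))"
proof (rule nat_transI)
  fix X :: "'v set" and v assume "v \<in> fobj K X"
  then obtain c x where c: "c \<in> Ob C" and x: "x \<in> out C c \<rightarrow>\<^sub>E X" and v: "v = code (c, x)"
    by (rule poly_cases)
  show "counit (cat_comonad C) X v \<in> fobj id_functor X"
    using x Ide_out[OF c] by (auto simp: v counit_code[OF c x])
  fix Y :: "'v set" and f assume f: "f \<in> X \<rightarrow>\<^sub>E Y"
  show "counit (cat_comonad C) Y (fmor K X Y f v) = fmor id_functor X Y f (counit (cat_comonad C) X v)"
    using Ide_out[OF c] compose_PiE[OF x f]
    by (simp add: v fmor_poly_code[OF c x] counit_code[OF c] x compose_eq)
qed (rule counit_extensional)

lemma comult_nat: "nat_trans K (K \<circ>\<^sub>F K) (comult (cat_comonad C))"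
proof (rule nat_transI)
  fix X :: "'v set" and v assume "v \<in> fobj K X"
  then obtain c x where c: "c \<in> Ob C" and x: "x \<in> out C c \<rightarrow>\<^sub>E X" and v: "v = code (c, x)"
    by (rule poly_cases)
  show "comult (cat_comonad C) X v \<in> fobj (K \<circ>\<^sub>F K) X"
    using code_in_poly[OF c splay_in[OF x]] by (simp add: v comult_code[OF c x])
  fix Y :: "'v set" and f assume f: "f \<in> X \<rightarrow>\<^sub>E Y"
  have "splay c (compose (out C c) f x) = compose (out C c) (fmor K X Y f) (splay c x)"
    unfolding splay_def compose_def[of _ "fmor K X Y f"]
    by (rule restrict_ext) (simp add: shift_compose fmor_poly_code[OF Cod_out shift_in[OF x]])
  then show "comult (cat_comonad C) Y (fmor K X Y f v) = fmor (K \<circ>\<^sub>F K) X Y f (comult (cat_comonad C) X v)"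
    using comult_code[OF c compose_PiE[OF x f]]
    by (simp add: v fmor_poly_code[OF c] x splay_in[OF x] comult_code[OF c x])
qed (rule comult_extensional)

text \<open>Evaluating \<open>splay c x\<close> at the identity gives back \<open>x\<close> by the
  right unit law; evaluating each \<open>shift x f\<close> at an identity gives \<open>x f\<close>
  by the left unit law. Coassociativity is the equality of \<open>shift (splay c x) f\<close> with
  \<open>splay (Cod C f) (shift x f)\<close>, that is, associativity of composition.\<close>

lemma comonad_cat_comonad: "comonad (cat_comonad C :: 'v comonad_data)"
proof -
  let ?k = "cat_comonad C :: 'v comonad_data"
  have laws: "counit ?k (fobj K X) (comult ?k X v) = v
      \<and> fmor K (fobj K X) X (counit ?k X) (comult ?k X v) = v
      \<and> comult ?k (fobj K X) (comult ?k X v)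
        = fmor K (fobj K X) (fobj K (fobj K X)) (comult ?k X) (comult ?k X v)"
    if v: "v \<in> fobj K X" for X v
  proof -
    obtain c x where c: "c \<in> Ob C" and x: "x \<in> out C c \<rightarrow>\<^sub>E X" and v: "v = code (c, x)"
      using v by (rule poly_cases)
    note \<delta>v = comult_code[OF c x, folded v] and sx = splay_in[OF x]
    have "counit ?k (fobj K X) (comult ?k X v) = v"
      unfolding \<delta>v counit_code[OF c sx]
      by (simp add: v splay_def Ide_out c cod_ide shift_Ide[OF c x])
    moreover have "compose (out C c) (counit ?k X) (splay c x) = x"
    proof (rule extensionalityI[where A = "out C c"])
      fix f assume f: "f \<in> out C c"
      have "shift x f (Ide C (Cod C f)) = x f"
        using f Ide_out[OF Cod_out[OF f]] comp_ide_left by (simp add: shift_def out_def)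
      then show "compose (out C c) (counit ?k X) (splay c x) f = x f"
        using f by (simp add: compose_eq splay_def counit_code[OF Cod_out[OF f] shift_in[OF x f]])
    qed (use x in \<open>auto simp: PiE_iff\<close>)
    moreover have "splay c (splay c x) = compose (out C c) (comult ?k X) (splay c x)"
    proof (rule extensionalityI[where A = "out C c"])
      fix f assume f: "f \<in> out C c"
      have "shift (splay c x) f = splay (Cod C f) (shift x f)"
        unfolding splay_def shift_def[of "restrict _ _"]
        by (rule restrict_ext) (simp add: f Comp_out[OF f] shift_shift[OF f])
      then show "splay c (splay c x) f = compose (out C c) (comult ?k X) (splay c x) f"
        using f by (simp add: compose_eq splay_def[of c] comult_code[OF Cod_out[OF f] shift_in[OF x f]])
    qed (auto simp: splay_def)
    ultimately show ?thesis
      unfolding \<delta>v by (simp add: fmor_poly_code[OF c sx] comult_code[OF c sx] v)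
  qed
  have "nt_eq (vcomp K (whisk_right (counit ?k) K) (comult ?k)) (nt_id K)"
    by (rule nt_eqI[where F = K]) (simp_all add: nt_id_def whisk_right_def laws)
  moreover have "nt_eq (vcomp K (whisk_left K K id_functor (counit ?k)) (comult ?k)) (nt_id K)"
    by (rule nt_eqI[where F = K]) (simp_all add: nt_id_def whisk_left_def laws)
  moreover have "nt_eq (vcomp K (whisk_right (comult ?k) K) (comult ?k))
      (vcomp K (whisk_left K K (K \<circ>\<^sub>F K) (comult ?k)) (comult ?k))"
    by (rule nt_eqI[where F = K]) (simp_all add: whisk_left_def whisk_right_def laws)
  ultimately show ?thesis
    unfolding comonad_def func_cat_comonad
    using poly_functor.set_functor_axioms counit_nat comult_nat by blast
qed

end

subsection \<open>Reconstructing a category from its comonad\<close>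

text \<open>For Yoneda: \<open>P\<close> is a copy of \<open>B i\<close> that is an object of
  \<open>Sets\<close>, and \<open>\<iota>\<close>, an element of the summand at \<open>i\<close>
  over \<open>P\<close>, is the generic element that takes the place of the identity on
  \<open>B i\<close>.\<close>

lemma (in small_family) fibre_encode:
  assumes "i \<in> I"
  obtains P and \<iota> :: "'b \<Rightarrow> 'v" where "P \<in> Sets" "\<iota> \<in> B i \<rightarrow>\<^sub>E P" "bij_betw \<iota> (B i) P"
proof -
  obtain e :: "'b \<Rightarrow> 'v" where "inj_on e (B i)" "e ` B i \<in> Sets"
    using small_encode small_fibre[OF assms] .
  then show thesis
    using that[of "e ` B i" "restrict e (B i)"] by (auto simp: bij_betw_def)
qed

text \<open>By Yoneda, a map between polynomial functors is determined by its values at the identities.\<close>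

lemma poly_nat_trans_repr:
  assumes "small_family TYPE('v) I B" "small_family TYPE('v) J E"
    and \<alpha>: "nat_trans (poly I B :: 'v setfun) (poly J E) \<alpha>"
  obtains \<phi> \<psi> where "\<And>i. i \<in> I \<Longrightarrow> \<phi> i \<in> J" "\<And>i. i \<in> I \<Longrightarrow> \<psi> i \<in> E (\<phi> i) \<rightarrow>\<^sub>E B i"
    and "\<And>i X x. \<lbrakk>i \<in> I; X \<in> Sets; x \<in> B i \<rightarrow>\<^sub>E X\<rbrakk> \<Longrightarrow>
      \<alpha> X (poly_code I B (i, x)) = poly_code J E (\<phi> i, compose (E (\<phi> i)) x (\<psi> i))"
proof -
  interpret I: small_family "TYPE('v)" I B by fact
  interpret J: small_family "TYPE('v)" J E by fact
  have "\<exists>j\<psi>. fst j\<psi> \<in> J \<and> snd j\<psi> \<in> E (fst j\<psi>) \<rightarrow>\<^sub>E B i \<and>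
      (\<forall>X x. X \<in> Sets \<longrightarrow> x \<in> B i \<rightarrow>\<^sub>E X \<longrightarrow>
        \<alpha> X (I.code (i, x)) = J.code (fst j\<psi>, compose (E (fst j\<psi>)) x (snd j\<psi>)))" if i: "i \<in> I" for i
  proof -
    obtain P and \<iota> :: "_ \<Rightarrow> 'v" where P: "P \<in> Sets" and \<iota>: "\<iota> \<in> B i \<rightarrow>\<^sub>E P"
      and bij: "bij_betw \<iota> (B i) P"
      using I.fibre_encode[OF i] .
    \<comment> \<open>\<open>j\<close> and \<open>y\<close> are the value of \<alpha> at the generic
      element; undoing the copy \<open>P\<close> of \<open>B i\<close> turns \<open>y\<close> into
      \<psi>.\<close>
    obtain j y where j: "j \<in> J" and y: "y \<in> E j \<rightarrow>\<^sub>E P" and \<alpha>P: "\<alpha> P (I.code (i, \<iota>)) = J.code (j, y)"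
      using nat_trans_apply[OF \<alpha> P I.code_in_poly[OF i \<iota>]] by (rule J.poly_cases)
    have inv: "inv_into (B i) \<iota> p \<in> B i" if "p \<in> P" for p
      using bij_betw_imp_surj_on[OF bij] that inv_into_into by metis
    define \<psi> where "\<psi> = (\<lambda>b\<in>E j. inv_into (B i) \<iota> (y b))"
    have "\<psi> \<in> E j \<rightarrow>\<^sub>E B i"
      using y inv unfolding \<psi>_def by auto
    moreover have "\<alpha> X (I.code (i, x)) = J.code (j, compose (E j) x \<psi>)"
      if X: "X \<in> Sets" and x: "x \<in> B i \<rightarrow>\<^sub>E X" for X x
    proof -
      \<comment> \<open>\<open>g\<close> sends the generic element to \<open>x\<close>, so
        naturality of \<alpha> at \<open>g\<close> gives the value at \<open>x\<close>.\<close>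
      define g where "g = (\<lambda>p\<in>P. x (inv_into (B i) \<iota> p))"
      have g: "g \<in> P \<rightarrow>\<^sub>E X"
        using x inv unfolding g_def by auto
      have "compose (B i) g \<iota> = x"
        by (rule extensionalityI[where A = "B i"])
          (use x \<iota> bij in \<open>auto simp: compose_eq g_def PiE_iff bij_betw_def\<close>)
      moreover have "compose (E j) g y = compose (E j) x \<psi>"
        using y unfolding compose_def g_def \<psi>_def by (intro restrict_ext) auto
      ultimately show ?thesis
        using nat_trans_natural[OF \<alpha> P X g I.code_in_poly[OF i \<iota>]]
        by (simp add: I.fmor_poly_code[OF i \<iota>] \<alpha>P J.fmor_poly_code[OF j y])
    qed
    ultimately show ?thesis
      using j by (intro exI[of _ "(j, \<psi>)"]) simp
  qed
  then obtain h where h: "\<And>i. i \<in> I \<Longrightarrow> fst (h i) \<in> J \<and> snd (h i) \<in> E (fst (h i)) \<rightarrow>\<^sub>E B i \<and>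
      (\<forall>X x. X \<in> Sets \<longrightarrow> x \<in> B i \<rightarrow>\<^sub>E X \<longrightarrow>
        \<alpha> X (I.code (i, x)) = J.code (fst (h i), compose (E (fst (h i))) x (snd (h i))))"
    by metis
  show thesis
    by (rule that[of "\<lambda>i. fst (h i)" "\<lambda>i. snd (h i)"]) (use h in blast)+
qed

text \<open>Sets of one element (the case of equal \<open>u\<close> and \<open>v\<close>) and of two
  elements are the test objects on which bijectivity of the data of a transformation is read
  off.\<close>

lemma (in small_family) doubleton_Sets: "{u, v} \<in> (Sets :: 'v set set)"
proof -
  have inf: "infinite (UNIV :: 'v set)"
    using universe unfolding set_universe_def by blast
  then have "\<nexists>f :: 'v \<Rightarrow> 'v. f ` {u, v} = UNIV"
    by (metis finite.emptyI finite.insertI finite_imageI)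
  then show ?thesis
    using card_of_ordLess2[of "UNIV :: 'v set" "{u, v}"] unfolding Sets_def small_def by simp
qed

text \<open>Over a singleton every summand has exactly one element, so bijectivity of \<alpha> there
  is bijectivity of \<phi>. The generic element of \<open>E (\<phi> i)\<close> lifts through
  \<alpha>, hence factors through \<open>\<psi> i\<close>, which is therefore injective. If
  \<open>\<psi> i\<close> missed a point \<open>b\<close>, two functions into a doubleton that
  differ only at \<open>b\<close> would have the same image under \<alpha>.\<close>

lemma poly_nat_iso_bij:
  assumes "small_family TYPE('v) I B" "small_family TYPE('v) J E"
    and \<alpha>: "\<And>X. X \<in> Sets \<Longrightarrow> bij_betw (\<alpha> X) (fobj (poly I B :: 'v setfun) X) (fobj (poly J E) X)"
    and \<phi>: "\<And>i. i \<in> I \<Longrightarrow> \<phi> i \<in> J" and \<psi>: "\<And>i. i \<in> I \<Longrightarrow> \<psi> i \<in> E (\<phi> i) \<rightarrow>\<^sub>E B i"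
    and repr: "\<And>i X x. \<lbrakk>i \<in> I; X \<in> Sets; x \<in> B i \<rightarrow>\<^sub>E X\<rbrakk> \<Longrightarrow>
      \<alpha> X (poly_code I B (i, x)) = poly_code J E (\<phi> i, compose (E (\<phi> i)) x (\<psi> i))"
  shows "bij_betw \<phi> I J" and "\<And>i. i \<in> I \<Longrightarrow> bij_betw (\<psi> i) (E (\<phi> i)) (B i)"
proof -
  interpret I: small_family "TYPE('v)" I B by fact
  interpret J: small_family "TYPE('v)" J E by fact
  have lift: "\<exists>i\<in>I. \<exists>x\<in>B i \<rightarrow>\<^sub>E X. j = \<phi> i \<and> y = compose (E j) x (\<psi> i)"
    if X: "X \<in> Sets" and j: "j \<in> J" and y: "y \<in> E j \<rightarrow>\<^sub>E X"
    for X :: "'v set" and j y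
  proof -
    have "J.code (j, y) \<in> \<alpha> X ` fobj (poly I B) X"
      using \<alpha>[OF X] J.code_in_poly[OF j y] by (simp add: bij_betw_def)
    then obtain v where v: "v \<in> fobj (poly I B) X" and jy: "J.code (j, y) = \<alpha> X v"
      by blast
    obtain i x where i: "i \<in> I" and x: "x \<in> B i \<rightarrow>\<^sub>E X" and "v = I.code (i, x)"
      using v by (rule I.poly_cases)
    then show ?thesis
      using jy J.code_eq_iff[OF j y \<phi>[OF i] compose_PiE[OF \<psi>[OF i] x]] repr[OF i X x] by auto
  qed
  have inj: "i = i' \<and> x = x'"
    if X: "X \<in> Sets" and "i \<in> I" "x \<in> B i \<rightarrow>\<^sub>E X" "i' \<in> I" "x' \<in> B i' \<rightarrow>\<^sub>E X"
      and "\<phi> i = \<phi> i'" "compose (E (\<phi> i)) x (\<psi> i) = compose (E (\<phi> i)) x' (\<psi> i')"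
    for X :: "'v set" and i x i' x'
  proof -
    have "\<alpha> X (I.code (i, x)) = \<alpha> X (I.code (i', x'))"
      using repr[OF that(2,1,3)] repr[OF that(4,1,5)] that(6,7) by metis
    then have "I.code (i, x) = I.code (i', x')"
      using \<alpha>[OF X] that I.code_in_poly unfolding bij_betw_def inj_on_def by blast
    then show ?thesis
      using that I.code_eq_iff by blast
  qed
  fix u :: 'v
  obtain w where "w \<noteq> u"
    using I.universe unfolding set_universe_def
    by (metis ex_new_if_finite finite.emptyI finite.insertI insertI1)
  have "inj_on \<phi> I"
  proof (rule inj_onI)
    fix i i' assume i: "i \<in> I" "i' \<in> I" "\<phi> i = \<phi> i'"
    then have "compose (E (\<phi> i)) (\<lambda>b\<in>B i. u) (\<psi> i) = compose (E (\<phi> i)) (\<lambda>b\<in>B i'. u) (\<psi> i')"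
      using \<psi>[OF i(1)] \<psi>[OF i(2)] unfolding compose_def by (intro restrict_ext) auto
    then show "i = i'"
      using inj[OF I.doubleton_Sets[of u u], of i "\<lambda>b\<in>B i. u" i' "\<lambda>b\<in>B i'. u"] i by auto
  qed
  moreover have "j \<in> \<phi> ` I" if "j \<in> J" for j
    using lift[OF I.doubleton_Sets[of u u] that, of "\<lambda>b\<in>E j. u"] by auto
  ultimately show \<phi>_bij: "bij_betw \<phi> I J"
    using \<phi> unfolding bij_betw_def by blast
  fix i assume i: "i \<in> I"
  obtain P and \<iota> :: "_ \<Rightarrow> 'v" where P: "P \<in> Sets" and \<iota>: "\<iota> \<in> E (\<phi> i) \<rightarrow>\<^sub>E P"
    and \<iota>_bij: "bij_betw \<iota> (E (\<phi> i)) P"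
    using J.fibre_encode[OF \<phi>[OF i]] .
  obtain x where "\<iota> = compose (E (\<phi> i)) x (\<psi> i)"
    using lift[OF P \<phi>[OF i] \<iota>] \<phi>_bij i unfolding bij_betw_def inj_on_def by blast
  then have "inj_on (\<psi> i) (E (\<phi> i))"
    using \<iota>_bij unfolding bij_betw_def inj_on_def by (metis compose_eq)
  moreover have "b \<in> \<psi> i ` E (\<phi> i)" if b: "b \<in> B i" for b
  proof (rule ccontr)
    assume "b \<notin> \<psi> i ` E (\<phi> i)"
    then have "compose (E (\<phi> i)) (\<lambda>b\<in>B i. u) (\<psi> i)
        = compose (E (\<phi> i)) (\<lambda>b'\<in>B i. if b' = b then w else u) (\<psi> i)"
      using \<psi>[OF i] unfolding compose_def by (intro restrict_ext) auto
    then have eq: "(\<lambda>b\<in>B i. u) = (\<lambda>b'\<in>B i. if b' = b then w else u)"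
      using inj[OF I.doubleton_Sets[of u w] i _ i, of "\<lambda>b\<in>B i. u"] by auto
    show False
      using fun_cong[OF eq, of b] \<open>w \<noteq> u\<close> b by simp
  qed
  ultimately show "bij_betw (\<psi> i) (E (\<phi> i)) (B i)"
    using \<psi>[OF i] unfolding bij_betw_def by blast
qed

text \<open>The maps \<open>\<psi> c\<close> on morphisms run against \<alpha>, from
  \<open>D\<close> to \<open>C\<close>, which explains the direction of the conclusion. The functor
  is the inverse \<open>G\<close> of \<phi> on objects, and on a morphism \<open>h\<close> it is
  \<psi> at the object \<open>G (Dom D h)\<close>. Compatibility of \<alpha> with counits at a
  generic element gives preservation of identities; compatibility with comultiplications gives
  codomains and composites.\<close>

lemma category_isomorphic_if_comonad_isomorphic:
  assumes "small_cat TYPE('v) C" "small_cat TYPE('v) D"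
    and "comonad_isomorphic (cat_comonad C :: 'v comonad_data) (cat_comonad D)"
  shows "category_isomorphic D C"
proof -
  interpret C: small_cat "TYPE('v)" C by fact
  interpret D: small_cat "TYPE('v)" D by fact
  obtain \<alpha> where nat: "nat_trans C.K D.K \<alpha>"
    and bij: "\<And>X. X \<in> Sets \<Longrightarrow> bij_betw (\<alpha> X) (fobj C.K X) (fobj D.K X)"
    and counit: "\<And>X v. X \<in> Sets \<Longrightarrow> v \<in> fobj C.K X \<Longrightarrow>
      counit (cat_comonad D) X (\<alpha> X v) = counit (cat_comonad C) X v"
    and comult: "\<And>X v. X \<in> Sets \<Longrightarrow> v \<in> fobj C.K X \<Longrightarrow> comult (cat_comonad D) X (\<alpha> X v)
      = \<alpha> (fobj D.K X) (fmor C.K (fobj C.K X) (fobj D.K X) (\<alpha> X) (comult (cat_comonad C) X v))"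
    using assms(3) by (rule comonad_isomorphicE) (simp only: C.func_cat_comonad D.func_cat_comonad)
  obtain \<phi> \<psi> where \<phi>: "\<And>c. c \<in> Ob C \<Longrightarrow> \<phi> c \<in> Ob D"
    and \<psi>: "\<And>c. c \<in> Ob C \<Longrightarrow> \<psi> c \<in> out D (\<phi> c) \<rightarrow>\<^sub>E out C c"
    and repr: "\<And>c X x. \<lbrakk>c \<in> Ob C; X \<in> Sets; x \<in> out C c \<rightarrow>\<^sub>E X\<rbrakk> \<Longrightarrow>
      \<alpha> X (C.code (c, x)) = D.code (\<phi> c, compose (out D (\<phi> c)) x (\<psi> c))"
    using poly_nat_trans_repr[OF C.small_family_axioms D.small_family_axioms nat] by blast
  note bijs = poly_nat_iso_bij[OF C.small_family_axioms D.small_family_axioms bij \<phi> \<psi> repr]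
  have \<phi>_bij: "bij_betw \<phi> (Ob C) (Ob D)"
    and \<psi>_bij: "\<And>c. c \<in> Ob C \<Longrightarrow> bij_betw (\<psi> c) (out D (\<phi> c)) (out C c)"
    using bijs by blast+
  have \<psi>_Ide: "\<psi> c (Ide D (\<phi> c)) = Ide C c" if c: "c \<in> Ob C" for c
  proof -
    obtain P and \<iota> :: "_ \<Rightarrow> 'v" where P: "P \<in> Sets" and \<iota>: "\<iota> \<in> out C c \<rightarrow>\<^sub>E P"
      and \<iota>_bij: "bij_betw \<iota> (out C c) P"
      using C.fibre_encode[OF c] .
    note I = D.Ide_out[OF \<phi>[OF c]]
    have "\<iota> (\<psi> c (Ide D (\<phi> c))) = \<iota> (Ide C c)"
      using counit[OF P C.code_in_poly[OF c \<iota>]] I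
      by (simp add: repr[OF c P \<iota>] C.counit_code[OF c \<iota>]
          D.counit_code[OF \<phi>[OF c] compose_PiE[OF \<psi>[OF c] \<iota>]] compose_eq)
    then show ?thesis
      using \<iota>_bij C.Ide_out[OF c] PiE_mem[OF \<psi>[OF c] I] unfolding bij_betw_def inj_on_def by blast
  qed
  \<comment> \<open>Both sides of the comultiplication condition at the generic element carry a
    function on \<open>out D (\<phi> c)\<close> whose values are codes. At \<open>h\<close>,
    equality of the indices of these codes is the statement on codomains, and equality of their
    functions at \<open>h'\<close> is the statement on composites.\<close>
  have \<psi>_Comp: "\<phi> (Cod C (\<psi> c h)) = Cod D h \<and>
      (\<forall>h'\<in>out D (Cod D h). \<psi> c (Comp D h' h) = Comp C (\<psi> (Cod C (\<psi> c h)) h') (\<psi> c h))"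
    if c: "c \<in> Ob C" and h: "h \<in> out D (\<phi> c)" for c h
  proof -
    obtain P and \<iota> :: "_ \<Rightarrow> 'v" where P: "P \<in> Sets" and \<iota>: "\<iota> \<in> out C c \<rightarrow>\<^sub>E P"
      and \<iota>_bij: "bij_betw \<iota> (out C c) P"
      using C.fibre_encode[OF c] .
    let ?y = "compose (out D (\<phi> c)) \<iota> (\<psi> c)" and ?d = "Cod C (\<psi> c h)"
    have y: "?y \<in> out D (\<phi> c) \<rightarrow>\<^sub>E P"
      by (rule compose_PiE[OF \<psi>[OF c] \<iota>])
    have \<psi>h: "\<psi> c h \<in> out C c"
      using \<psi>[OF c] h by blast
    note d = C.Cod_out[OF \<psi>h] and s\<iota> = C.splay_in[OF \<iota>] and sh = C.shift_in[OF \<iota> \<psi>h]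
    let ?z = "compose (out C c) (\<alpha> P) (C.splay c \<iota>)"
    have z: "?z \<in> out C c \<rightarrow>\<^sub>E fobj D.K P"
      by (rule compose_PiE[OF s\<iota> nat_trans.component[OF nat P]])
    note KP = D.poly_functor.obj_closed[OF P]
    have "D.code (\<phi> c, D.splay (\<phi> c) ?y) = D.code (\<phi> c, compose (out D (\<phi> c)) ?z (\<psi> c))"
      using comult[OF P C.code_in_poly[OF c \<iota>]]
      by (simp add: repr[OF c P \<iota>] C.comult_code[OF c \<iota>] D.comult_code[OF \<phi>[OF c] y]
          C.fmor_poly_code[OF c s\<iota>] repr[OF c KP z])
    then have "D.splay (\<phi> c) ?y = compose (out D (\<phi> c)) ?z (\<psi> c)"
      using D.code_eq_iff[OF \<phi>[OF c] D.splay_in[OF y] \<phi>[OF c] compose_PiE[OF \<psi>[OF c] z]] by simp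
    then have "D.splay (\<phi> c) ?y h = ?z (\<psi> c h)"
      using h by (simp add: compose_eq)
    then have "D.code (Cod D h, D.shift ?y h)
        = D.code (\<phi> ?d, compose (out D (\<phi> ?d)) (C.shift \<iota> (\<psi> c h)) (\<psi> ?d))"
      using h \<psi>h by (simp add: D.splay_def C.splay_def compose_eq repr[OF d P sh])
    then have d\<phi>: "Cod D h = \<phi> ?d"
      and eq: "D.shift ?y h = compose (out D (\<phi> ?d)) (C.shift \<iota> (\<psi> c h)) (\<psi> ?d)"
      using D.code_eq_iff[OF D.Cod_out[OF h] D.shift_in[OF y h] \<phi>[OF d] compose_PiE[OF \<psi>[OF d] sh]]
      by blast+
    have "\<psi> c (Comp D h' h) = Comp C (\<psi> ?d h') (\<psi> c h)" if h': "h' \<in> out D (Cod D h)" for h'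
    proof -
      have \<psi>h': "\<psi> ?d h' \<in> out C ?d"
        using \<psi>[OF d] h' d\<phi> by auto
      have hh: "Comp D h' h \<in> out D (\<phi> c)"
        by (rule D.Comp_out(1)[OF h h'])
      have "\<iota> (\<psi> c (Comp D h' h)) = \<iota> (Comp C (\<psi> ?d h') (\<psi> c h))"
        using fun_cong[OF eq, of h'] h' hh \<psi>h' d\<phi>
        by (simp add: D.shift_def C.shift_def compose_eq)
      then show ?thesis
        using \<iota>_bij PiE_mem[OF \<psi>[OF c] hh] C.Comp_out(1)[OF \<psi>h \<psi>h']
        unfolding bij_betw_def inj_on_def by blast
    qed
    then show ?thesis
      using d\<phi> by simp
  qed
  define G where "G = inv_into (Ob C) \<phi>"
  have G: "G d \<in> Ob C" "\<phi> (G d) = d" if "d \<in> Ob D" for d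
    using \<phi>_bij that unfolding G_def bij_betw_def by (auto intro: inv_into_into f_inv_into_f)
  have G\<phi>: "G (\<phi> c) = c" if "c \<in> Ob C" for c
    using \<phi>_bij that unfolding G_def bij_betw_def by simp
  have G_bij: "bij_betw G (Ob D) (Ob C)"
    unfolding G_def by (rule bij_betw_inv_into[OF \<phi>_bij])
  define \<Psi> where "\<Psi> h = \<psi> (G (Dom D h)) h" for h
  have h_out: "h \<in> out D (\<phi> (G (Dom D h)))" if "h \<in> Arr D" for h
    using that G(2)[OF D.dom_ob] by (simp add: out_def)
  have \<Psi>_out: "\<Psi> h \<in> out C (G (Dom D h))" if "h \<in> Arr D" for h
    unfolding \<Psi>_def by (rule PiE_mem[OF \<psi>[OF G(1)[OF D.dom_ob[OF that]]] h_out[OF that]])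
  have \<Psi>_Dom: "Dom C (\<Psi> h) = G (Dom D h)" if "h \<in> Arr D" for h
    using C.outD(2)[OF \<Psi>_out[OF that]] .
  have \<Psi>_Cod: "Cod C (\<Psi> h) = G (Cod D h)" if "h \<in> Arr D" for h
    using \<psi>_Comp[OF G(1)[OF D.dom_ob[OF that]] h_out[OF that]] G\<phi>[OF C.Cod_out[OF \<Psi>_out[OF that]]]
    unfolding \<Psi>_def by simp
  have "inj_on \<Psi> (Arr D)"
  proof (rule inj_onI)
    fix h h' assume h: "h \<in> Arr D" "h' \<in> Arr D" and eq: "\<Psi> h = \<Psi> h'"
    then have "G (Dom D h) = G (Dom D h')"
      using \<Psi>_Dom by metis
    then have "h' \<in> out D (\<phi> (G (Dom D h)))" "\<psi> (G (Dom D h)) h = \<psi> (G (Dom D h)) h'"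
      using eq h_out[OF h(2)] unfolding \<Psi>_def by simp_all
    then show "h = h'"
      using h_out[OF h(1)] \<psi>_bij[OF G(1)[OF D.dom_ob[OF h(1)]]]
      unfolding bij_betw_def inj_on_def by blast
  qed
  moreover have "f \<in> \<Psi> ` Arr D" if f: "f \<in> Arr C" for f
  proof -
    have c: "Dom C f \<in> Ob C"
      by (rule C.dom_ob[OF f])
    have "f \<in> out C (Dom C f)"
      using f by (simp add: out_def)
    then obtain h where h: "h \<in> out D (\<phi> (Dom C f))" and \<psi>h: "\<psi> (Dom C f) h = f"
      using \<psi>_bij[OF c] unfolding bij_betw_def by (metis imageE)
    have "\<Psi> h = f"
      unfolding \<Psi>_def D.outD(2)[OF h] G\<phi>[OF c] by (rule \<psi>h)
    then show ?thesis
      using D.outD(1)[OF h] by blast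
  qed
  ultimately have "bij_betw \<Psi> (Arr D) (Arr C)"
    using \<Psi>_out C.outD(1) unfolding bij_betw_def by blast
  moreover have "\<Psi> (Ide D d) = Ide C (G d)" if d: "d \<in> Ob D" for d
    using \<psi>_Ide[OF G(1)[OF d]] by (simp add: \<Psi>_def D.dom_ide[OF d] G(2)[OF d])
  moreover have "\<Psi> (Comp D g f) = Comp C (\<Psi> g) (\<Psi> f)"
    if f: "f \<in> Arr D" and g: "g \<in> Arr D" and gf: "Dom D g = Cod D f" for f g
    using \<psi>_Comp[OF G(1)[OF D.dom_ob[OF f]] h_out[OF f]] \<Psi>_Cod[OF f] g gf
    by (simp add: \<Psi>_def D.dom_comp[OF f g gf] out_def)
  ultimately show ?thesis
    unfolding category_isomorphic_def
    using G_bij \<Psi>_Dom \<Psi>_Cod by (intro exI[of _ G] exI[of _ \<Psi>]) simp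
qed

subsection \<open>The product completion\<close>

locale small_family_cat =
  U: small_family V U El + C: small_cat V C
  for V :: "'v itself" and U :: "'a set" and El :: "'a \<Rightarrow> 'b set" and C :: "('o, 'm) cat"
begin

abbreviation PC :: "(('a, 'b, 'o) pc_ob, ('a, 'b, 'o, 'm) pc_arr) cat" where
  "PC \<equiv> product_completion U El C"

lemma Ob_PC: "Ob PC = (SIGMA A:U. El A \<rightarrow>\<^sub>E Ob C)"
  by (simp add: product_completion_def Let_def)

lemma Arr_PC_iff:
  "(s, t, \<phi>, f) \<in> Arr PC \<longleftrightarrow> s \<in> Ob PC \<and> t \<in> Ob PC \<and> \<phi> \<in> El (fst t) \<rightarrow>\<^sub>E El (fst s) \<and>
    f \<in> extensional (El (fst t)) \<and>
    (\<forall>a\<in>El (fst t). f a \<in> Arr C \<and> Dom C (f a) = snd s (\<phi> a) \<and> Cod C (f a) = snd t a)"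
  by (cases s; cases t) (auto simp: product_completion_def Let_def PiE_iff)

lemma Dom_PC [simp]: "Dom PC (s, t, \<phi>, f) = s"
  and Cod_PC [simp]: "Cod PC (s, t, \<phi>, f) = t"
  and Ide_PC: "Ide PC (A, c) = ((A, c), (A, c), \<lambda>a\<in>El A. a, \<lambda>a\<in>El A. Ide C (c a))"
  and Comp_PC: "Comp PC (s', t', \<phi>', f') (s, t, \<phi>, f) =
    (s, t', compose (El (fst t')) \<phi> \<phi>', \<lambda>a\<in>El (fst t'). Comp C (f' a) (f (\<phi>' a)))"
  by (simp_all add: product_completion_def Let_def)

lemma category_PC: "category PC"
proof
  fix m assume "m \<in> Arr PC"
  then show "Dom PC m \<in> Ob PC" "Cod PC m \<in> Ob PC"
    by (cases m; simp add: Arr_PC_iff)+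
next
  fix s assume "s \<in> Ob PC"
  then show "Ide PC s \<in> Arr PC"
    by (cases s) (auto simp: Ide_PC Arr_PC_iff Ob_PC C.ide_arr C.dom_ide C.cod_ide PiE_iff)
  show "Dom PC (Ide PC s) = s" "Cod PC (Ide PC s) = s"
    by (cases s; simp add: Ide_PC)+
next
  fix m n assume m: "m \<in> Arr PC" and n: "n \<in> Arr PC" and nm: "Dom PC n = Cod PC m"
  obtain s t \<phi> f where m_def: "m = (s, t, \<phi>, f)"
    by (cases m)
  obtain t' \<psi> g where n_def: "n = (t, t', \<psi>, g)"
    using nm by (cases n) (simp add: m_def)
  have \<psi>: "\<psi> \<in> El (fst t') \<rightarrow>\<^sub>E El (fst t)" and \<phi>: "\<phi> \<in> El (fst t) \<rightarrow>\<^sub>E El (fst s)"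
    using m n unfolding m_def n_def Arr_PC_iff by blast+
  have "\<psi> a \<in> El (fst t)" if "a \<in> El (fst t')" for a
    by (rule PiE_mem[OF \<psi> that])
  then show "Comp PC n m \<in> Arr PC"
    using m n compose_PiE[OF \<psi> \<phi>] unfolding m_def n_def Comp_PC Arr_PC_iff
    by (simp add: compose_eq C.comp_arr C.dom_comp C.cod_comp)
  show "Dom PC (Comp PC n m) = Dom PC m" "Cod PC (Comp PC n m) = Cod PC n"
    by (simp_all add: m_def n_def Comp_PC)
next
  fix m assume m: "m \<in> Arr PC"
  obtain A c A' c' \<phi> f where m_def: "m = ((A, c), (A', c'), \<phi>, f)"
    by (cases m) auto
  have f: "f \<in> extensional (El A')" and \<phi>: "\<phi> \<in> El A' \<rightarrow>\<^sub>E El A"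
    and fa: "\<And>a. a \<in> El A' \<Longrightarrow> f a \<in> Arr C \<and> Dom C (f a) = c (\<phi> a) \<and> Cod C (f a) = c' a"
    using m unfolding m_def Arr_PC_iff by auto
  have "compose (El A') (\<lambda>a\<in>El A. a) \<phi> = \<phi>" "compose (El A') \<phi> (\<lambda>a\<in>El A'. a) = \<phi>"
    using \<phi> by (auto intro!: Id_compose compose_Id simp: PiE_def)
  moreover have "(\<lambda>a\<in>El A'. Comp C (f a) ((\<lambda>a\<in>El A. Ide C (c a)) (\<phi> a))) = f"
      "(\<lambda>a\<in>El A'. Comp C ((\<lambda>a\<in>El A'. Ide C (c' a)) a) (f ((\<lambda>a\<in>El A'. a) a))) = f"
    using \<phi> fa C.comp_ide_right C.comp_ide_left
    by (auto intro!: extensionalityI[OF _ f])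
      (metis PiE_mem fa C.comp_ide_right C.comp_ide_left)+
  ultimately show "Comp PC m (Ide PC (Dom PC m)) = m" "Comp PC (Ide PC (Cod PC m)) m = m"
    by (simp_all add: m_def Ide_PC Comp_PC)
next
  fix m n k assume m: "m \<in> Arr PC" and n: "n \<in> Arr PC" and k: "k \<in> Arr PC"
    and nm: "Dom PC n = Cod PC m" and kn: "Dom PC k = Cod PC n"
  obtain s t \<phi> f where m_def: "m = (s, t, \<phi>, f)"
    by (cases m)
  obtain t' \<psi> g where n_def: "n = (t, t', \<psi>, g)"
    using nm by (cases n) (simp add: m_def)
  obtain t'' \<chi> h where k_def: "k = (t', t'', \<chi>, h)"
    using kn by (cases k) (simp add: n_def)
  have \<chi>: "\<chi> a \<in> El (fst t')" if "a \<in> El (fst t'')" for a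
    using k that unfolding k_def Arr_PC_iff by blast
  have \<psi>: "\<psi> a \<in> El (fst t)" if "a \<in> El (fst t')" for a
    using n that unfolding n_def Arr_PC_iff by blast
  show "Comp PC k (Comp PC n m) = Comp PC (Comp PC k n) m"
    using m n k \<chi> \<psi> unfolding m_def n_def k_def Comp_PC Arr_PC_iff
    by (auto simp: compose_def C.comp_assoc intro!: restrict_ext)
qed

lemma small_Ob_PC: "small TYPE('v) (Ob PC)"
  unfolding Ob_PC
  by (intro small_Sigma[OF U.universe U.small_index] small_PiE[OF U.universe U.small_fibre] C.small_Ob)

lemma small_Arr_PC: "small TYPE('v) (Arr PC)"
proof (rule small_subset)
  show "Arr PC \<subseteq> (SIGMA s:Ob PC. SIGMA t:Ob PC.
      (El (fst t) \<rightarrow>\<^sub>E El (fst s)) \<times> (El (fst t) \<rightarrow>\<^sub>E Arr C))"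
    by (auto simp: Arr_PC_iff PiE_iff intro: extensional_arb)
  have "small TYPE('v) (El (fst s))" if "s \<in> Ob PC" for s
    using that U.small_fibre by (auto simp: Ob_PC)
  then show "small TYPE('v) (SIGMA s:Ob PC. SIGMA t:Ob PC.
      (El (fst t) \<rightarrow>\<^sub>E El (fst s)) \<times> (El (fst t) \<rightarrow>\<^sub>E Arr C))"
    by (intro small_Sigma[OF U.universe] small_PiE[OF U.universe] small_Ob_PC C.small_Arr) blast+
qed

sublocale P: small_cat V PC
proof -
  interpret category PC
    by (rule category_PC)
  show "small_cat TYPE('v) PC"
    by unfold_locales (fact U.universe small_Ob_PC small_Arr_PC)+
qed

lemma out_PC_cases:
  assumes "m \<in> out PC s"
  obtains A' c' \<phi> f where "m = (s, (A', c'), \<phi>, f)" "s \<in> Ob PC" "A' \<in> U" "c' \<in> El A' \<rightarrow>\<^sub>E Ob C"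
    "\<phi> \<in> El A' \<rightarrow>\<^sub>E El (fst s)" "f \<in> extensional (El A')"
    "\<And>a. a \<in> El A' \<Longrightarrow> f a \<in> out C (snd s (\<phi> a))" "\<And>a. a \<in> El A' \<Longrightarrow> Cod C (f a) = c' a"
proof -
  obtain s' A' c' \<phi> f where m: "m = (s', (A', c'), \<phi>, f)"
    by (cases m) auto
  then have "s' = s"
    using assms by (simp add: out_def)
  with m show thesis
    using that[of A' c' \<phi> f] assms by (auto simp: out_def Arr_PC_iff Ob_PC)
qed


subsection \<open>The left Kan extension\<close>

abbreviation u :: "'v setfun" where
  "u \<equiv> poly U El"

text \<open>Decoded coordinates for the elements of \<open>u (k X)\<close>. The family
  \<open>x\<close> is constrained only on \<open>El A\<close>, so an element does not determine it;
  \<open>act_cong\<close> states the independence that is needed.\<close>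

definition params :: "'a \<Rightarrow> ('b \<Rightarrow> 'o) \<Rightarrow> ('b \<Rightarrow> 'm \<Rightarrow> 'v) \<Rightarrow> 'v set \<Rightarrow> bool" where
  "params A c x X \<longleftrightarrow> (A, c) \<in> Ob PC \<and> (\<forall>a\<in>El A. x a \<in> out C (c a) \<rightarrow>\<^sub>E X)"

definition elt :: "'a \<Rightarrow> ('b \<Rightarrow> 'o) \<Rightarrow> ('b \<Rightarrow> 'm \<Rightarrow> 'v) \<Rightarrow> 'v" where
  "elt A c x = U.code (A, \<lambda>a\<in>El A. C.code (c a, x a))"

text \<open>A morphism out of \<open>(A, c)\<close> makes an element of \<open>u X\<close> from a
  family \<open>x\<close>: reindex along \<phi>, then evaluate at the components of the morphism.
  Its target contributes the index in \<open>U\<close>.\<close>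

definition pull :: "('b \<Rightarrow> 'm \<Rightarrow> 'v) \<Rightarrow> ('a, 'b, 'o, 'm) pc_arr \<Rightarrow> 'v" where
  "pull x = (\<lambda>(s, t, \<phi>, f). U.code (fst t, \<lambda>a\<in>El (fst t). x (\<phi> a) (f a)))"

definition act :: "('a, 'b, 'o) pc_ob \<Rightarrow> ('b \<Rightarrow> 'm \<Rightarrow> 'v) \<Rightarrow> ('a, 'b, 'o, 'm) pc_arr \<Rightarrow> 'v" where
  "act s x = (\<lambda>m\<in>out PC s. pull x m)"

text \<open>The index \<open>(A, c)\<close> is kept, and the family becomes the function evaluating
  it along all morphisms out of \<open>(A, c)\<close>.\<close>

definition unit :: "'v set \<Rightarrow> 'v \<Rightarrow> 'v" where
  "unit X = (\<lambda>v\<in>fobj u (fobj C.K X). case poly_decode U El v of (A, h) \<Rightarrow>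
     let c = \<lambda>a\<in>El A. fst (poly_decode (Ob C) (out C) (h a));
         x = \<lambda>a. snd (poly_decode (Ob C) (out C) (h a))
     in P.code ((A, c), act (A, c) x))"

lemma paramsD:
  assumes "params A c x X"
  shows "(A, c) \<in> Ob PC" "A \<in> U" "c \<in> El A \<rightarrow>\<^sub>E Ob C" "\<And>a. a \<in> El A \<Longrightarrow> c a \<in> Ob C"
    "\<And>a. a \<in> El A \<Longrightarrow> x a \<in> out C (c a) \<rightarrow>\<^sub>E X"
  using assms unfolding params_def Ob_PC by auto

lemma elt_in:
  assumes "params A c x X"
  shows "(\<lambda>a\<in>El A. C.code (c a, x a)) \<in> El A \<rightarrow>\<^sub>E fobj C.K X" "elt A c x \<in> fobj u (fobj C.K X)"
proof -
  show "(\<lambda>a\<in>El A. C.code (c a, x a)) \<in> El A \<rightarrow>\<^sub>E fobj C.K X"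
    using C.code_in_poly paramsD[OF assms] by simp
  then show "elt A c x \<in> fobj u (fobj C.K X)"
    unfolding elt_def using U.code_in_poly paramsD(2)[OF assms] by blast
qed

lemma elt_cases:
  assumes "v \<in> fobj u (fobj C.K X)"
  obtains A c x where "params A c x X" "v = elt A c x"
proof -
  obtain A h where A: "A \<in> U" and h: "h \<in> El A \<rightarrow>\<^sub>E fobj C.K X" and v: "v = U.code (A, h)"
    using assms by (rule U.poly_cases)
  have "\<exists>p. fst p \<in> Ob C \<and> snd p \<in> out C (fst p) \<rightarrow>\<^sub>E X \<and> h a = C.code p" if a: "a \<in> El A" for a
    using PiE_mem[OF h a] by (rule C.poly_cases) (metis fst_conv snd_conv)
  then obtain p where p: "\<And>a. a \<in> El A \<Longrightarrow>
      fst (p a) \<in> Ob C \<and> snd (p a) \<in> out C (fst (p a)) \<rightarrow>\<^sub>E X \<and> h a = C.code (p a)"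
    by metis
  let ?c = "\<lambda>a\<in>El A. fst (p a)" and ?x = "\<lambda>a. snd (p a)"
  have "params A ?c ?x X"
    using A p by (simp add: params_def Ob_PC)
  moreover have "h = (\<lambda>a\<in>El A. C.code (?c a, ?x a))"
    using h p by (intro extensionalityI[where A = "El A"]) (auto simp: PiE_iff)
  ultimately show thesis
    using that v unfolding elt_def by blast
qed

lemma act_in: "params A c x X \<Longrightarrow> act (A, c) x \<in> out PC (A, c) \<rightarrow>\<^sub>E fobj u X"
  unfolding act_def
proof (intro restrict_PiE_iff[THEN iffD2] ballI)
  fix m assume params: "params A c x X" and m: "m \<in> out PC (A, c)"
  obtain A' c' \<phi> f where m_def: "m = ((A, c), (A', c'), \<phi>, f)" and A': "A' \<in> U"
    and \<phi>: "\<phi> \<in> El A' \<rightarrow>\<^sub>E El (fst (A, c))" and f: "\<And>a. a \<in> El A' \<Longrightarrow> f a \<in> out C (snd (A, c) (\<phi> a))"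
    using m by (rule out_PC_cases) blast
  have "x (\<phi> a) (f a) \<in> X" if "a \<in> El A'" for a
    using paramsD(5)[OF params] \<phi> f that by fastforce
  then show "pull x m \<in> fobj u X"
    unfolding m_def pull_def using A' by (auto intro!: U.code_in_poly)
qed

lemma act_cong:
  assumes "\<And>a g. a \<in> El (fst s) \<Longrightarrow> g \<in> out C (snd s a) \<Longrightarrow> x a g = y a g"
  shows "act s x = act s y"
  unfolding act_def
proof (rule restrict_ext)
  fix m assume "m \<in> out PC s"
  then show "pull x m = pull y m"
  proof (rule out_PC_cases)
    fix A' c' \<phi> f assume "m = (s, (A', c'), \<phi>, f)" "\<phi> \<in> El A' \<rightarrow>\<^sub>E El (fst s)"
      "\<And>a. a \<in> El A' \<Longrightarrow> f a \<in> out C (snd s (\<phi> a))"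
    moreover from this have "(\<lambda>a\<in>El A'. x (\<phi> a) (f a)) = (\<lambda>a\<in>El A'. y (\<phi> a) (f a))"
      using assms by (intro restrict_ext) blast
    ultimately show ?thesis
      by (simp add: pull_def)
  qed
qed

lemma unit_elt:
  assumes "params A c x X"
  shows "unit X (elt A c x) = P.code ((A, c), act (A, c) x)"
proof -
  note p = paramsD[OF assms]
  let ?h = "\<lambda>a\<in>El A. C.code (c a, x a)"
  have dec: "poly_decode (Ob C) (out C) (?h a) = (c a, x a)" if "a \<in> El A" for a
    using C.poly_decode_code[OF p(4,5)] that by simp
  then have "(\<lambda>a\<in>El A. fst (poly_decode (Ob C) (out C) (?h a))) = c"
    using p(3) by (intro extensionalityI[where A = "El A"]) (auto simp: PiE_iff)
  moreover have "act (A, c) (\<lambda>a. snd (poly_decode (Ob C) (out C) (?h a))) = act (A, c) x"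
    by (rule act_cong) (simp only: fst_conv snd_conv dec)
  moreover have "poly_decode U El (elt A c x) = (A, ?h)"
    unfolding elt_def by (rule U.poly_decode_code[OF p(2) elt_in(1)[OF assms]])
  ultimately show ?thesis
    unfolding unit_def restrict_apply'[OF elt_in(2)[OF assms]] by (simp only: prod.case Let_def)
qed

lemma params_compose:
  assumes "params A c x X" "g \<in> X \<rightarrow>\<^sub>E Y"
  shows "params A c (\<lambda>a. compose (out C (c a)) g (x a)) Y"
  using assms(1) unfolding params_def by (metis compose_PiE[OF _ assms(2)])

lemma fmor_uK_elt:
  assumes "params A c x X"
  shows "fmor u (fobj C.K X) (fobj C.K Y) (fmor C.K X Y g) (elt A c x)
    = elt A c (\<lambda>a. compose (out C (c a)) g (x a))"
proof -
  have "compose (El A) (fmor C.K X Y g) (\<lambda>a\<in>El A. C.code (c a, x a))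
      = (\<lambda>a\<in>El A. C.code (c a, compose (out C (c a)) g (x a)))"
    unfolding compose_def[of "El A"]
    by (rule restrict_ext) (simp add: C.fmor_poly_code[OF paramsD(4,5)[OF assms]])
  then show ?thesis
    unfolding elt_def U.fmor_poly_code[OF paramsD(2)[OF assms] elt_in(1)[OF assms]] by (rule arg_cong)
qed

text \<open>Postcomposition with \<open>g\<close> commutes with reindexing and evaluation. This is
  naturality of \<open>unit\<close> on the second components.\<close>

lemma fmor_u_act:
  assumes "params A c x X"
  shows "compose (out PC (A, c)) (fmor u X Y g) (act (A, c) x)
    = act (A, c) (\<lambda>a. compose (out C (c a)) g (x a))"
  unfolding act_def compose_def[of "out PC (A, c)"]
proof (rule restrict_ext)
  fix m assume m: "m \<in> out PC (A, c)"
  obtain A' c' \<phi> f where m_def: "m = ((A, c), (A', c'), \<phi>, f)" and A': "A' \<in> U"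
    and \<phi>: "\<phi> \<in> El A' \<rightarrow>\<^sub>E El (fst (A, c))" and f: "\<And>a. a \<in> El A' \<Longrightarrow> f a \<in> out C (snd (A, c) (\<phi> a))"
    using m by (rule out_PC_cases) blast
  have f': "f a \<in> out C (c (\<phi> a))" if "a \<in> El A'" for a
    using f[OF that] by simp
  have "x (\<phi> a) (f a) \<in> X" if "a \<in> El A'" for a
    using paramsD(5)[OF assms] \<phi> f' that by fastforce
  then have y: "(\<lambda>a\<in>El A'. x (\<phi> a) (f a)) \<in> El A' \<rightarrow>\<^sub>E X"
    by simp
  have "compose (El A') g (\<lambda>a\<in>El A'. x (\<phi> a) (f a))
      = (\<lambda>a\<in>El A'. compose (out C (c (\<phi> a))) g (x (\<phi> a)) (f a))"
    unfolding compose_def[of "El A'"] by (rule restrict_ext) (simp add: f' compose_eq)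
  then show "fmor u X Y g (restrict (pull x) (out PC (A, c)) m)
      = pull (\<lambda>a. compose (out C (c a)) g (x a)) m"
    using m U.fmor_poly_code[OF A' y] by (simp add: m_def pull_def)
qed

lemma unit_nat: "nat_trans (u \<circ>\<^sub>F C.K) (P.K \<circ>\<^sub>F u) unit"
proof (rule nat_transI)
  fix X :: "'v set" and v assume "v \<in> fobj (u \<circ>\<^sub>F C.K) X"
  then have "v \<in> fobj u (fobj C.K X)"
    by simp
  then obtain A c x where p: "params A c x X" and v: "v = elt A c x"
    by (rule elt_cases)
  show "unit X v \<in> fobj (P.K \<circ>\<^sub>F u) X"
    using P.code_in_poly[OF paramsD(1)[OF p] act_in[OF p]] by (simp add: v unit_elt[OF p])
  fix Y :: "'v set" and g assume g: "g \<in> X \<rightarrow>\<^sub>E Y"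
  show "unit Y (fmor (u \<circ>\<^sub>F C.K) X Y g v) = fmor (P.K \<circ>\<^sub>F u) X Y g (unit X v)"
    using unit_elt[OF params_compose[OF p g]] fmor_u_act[OF p]
    by (simp add: v unit_elt[OF p] fmor_uK_elt[OF p] P.fmor_poly_code[OF paramsD(1)[OF p] act_in[OF p]])
qed (simp add: unit_def)

text \<open>
  The set of pairs \<open>(a, g)\<close> with \<open>g\<close> a morphism out of \<open>c a\<close> represents the summand of \<open>u \<circ> K\<close>
  indexed by \<open>(A, c)\<close>; by \<open>act_bij\<close>, applying \<open>u\<close> to it gives the set of morphisms out of \<open>(A, c)\<close>.
\<close>

definition fan :: "('a, 'b, 'o) pc_ob \<Rightarrow> ('b \<times> 'm) set" where
  "fan s = (SIGMA a:El (fst s). out C (snd s a))"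

definition fan_code :: "('a, 'b, 'o) pc_ob \<Rightarrow> 'b \<times> 'm \<Rightarrow> 'v" where
  "fan_code s = (SOME e. inj_on e (fan s) \<and> e ` fan s \<in> Sets)"

text \<open>The generic family: when families into \<open>X\<close> are identified with maps from
  \<open>rep s\<close> to \<open>X\<close>, it corresponds to the identity of
  \<open>rep s\<close>.\<close>

definition gen :: "('a, 'b, 'o) pc_ob \<Rightarrow> 'b \<Rightarrow> 'm \<Rightarrow> 'v" where
  "gen s a = (\<lambda>g\<in>out C (snd s a). fan_code s (a, g))"

abbreviation rep :: "('a, 'b, 'o) pc_ob \<Rightarrow> 'v set" where
  "rep s \<equiv> fan_code s ` fan s"

lemma fan_code:
  assumes "s \<in> Ob PC"
  shows "inj_on (fan_code s) (fan s)" "rep s \<in> Sets"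
proof -
  have "snd s a \<in> Ob C" if "a \<in> El (fst s)" for a
    using assms that by (auto simp: Ob_PC)
  then have "small TYPE('v) (fan s)"
    unfolding fan_def using assms
    by (intro small_Sigma[OF U.universe]) (auto simp: Ob_PC U.small_fibre C.small_fibre)
  then obtain e :: "'b \<times> 'm \<Rightarrow> 'v" where "inj_on e (fan s) \<and> e ` fan s \<in> Sets"
    using small_encode by blast
  then have "inj_on (fan_code s) (fan s) \<and> rep s \<in> Sets"
    unfolding fan_code_def by (rule someI[of "\<lambda>e. inj_on e (fan s) \<and> e ` fan s \<in> Sets"])
  then show "inj_on (fan_code s) (fan s)" "rep s \<in> Sets"
    by blast+
qed

lemma params_gen:
  assumes "(A, c) \<in> Ob PC"
  shows "params A c (gen (A, c)) (rep (A, c))"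
  using assms unfolding params_def gen_def fan_def by auto

lemma act_bij:
  assumes s: "(A, c) \<in> Ob PC"
  shows "bij_betw (act (A, c) (gen (A, c))) (out PC (A, c)) (fobj u (rep (A, c)))"
  unfolding bij_betw_def
proof
  let ?s = "(A, c)"
  note code_inj = fan_code(1)[OF s]
  \<comment> \<open>On the generic family, \<open>act\<close> records the pairs
    \<open>(\<phi> a, f a)\<close> through their codes, so \<phi> and \<open>f\<close> can be read
    back from the result.\<close>
  have act_eq: "act ?s (gen ?s) m = U.code (A', \<lambda>a\<in>El A'. fan_code ?s (\<phi> a, f a))"
    if "m \<in> out PC ?s" and m: "m = (?s, (A', c'), \<phi>, f)" and "\<forall>a\<in>El A'. f a \<in> out C (snd ?s (\<phi> a))"
    for m A' c' \<phi> f
    using that(1,3) unfolding act_def m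
    by (auto simp: pull_def gen_def intro!: arg_cong[where f = U.code] restrict_ext)
  show "inj_on (act ?s (gen ?s)) (out PC ?s)"
  proof (rule inj_onI)
    fix m n assume m: "m \<in> out PC ?s" and n: "n \<in> out PC ?s"
      and eq: "act ?s (gen ?s) m = act ?s (gen ?s) n"
    obtain A' c' \<phi> f where m_def: "m = (?s, (A', c'), \<phi>, f)" and A': "A' \<in> U"
      and c': "c' \<in> El A' \<rightarrow>\<^sub>E Ob C"
      and \<phi>: "\<phi> \<in> El A' \<rightarrow>\<^sub>E El (fst ?s)" and f_ext: "f \<in> extensional (El A')"
      and f: "\<And>a. a \<in> El A' \<Longrightarrow> f a \<in> out C (snd ?s (\<phi> a))"
      and f_cod: "\<And>a. a \<in> El A' \<Longrightarrow> Cod C (f a) = c' a"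
      using m by (rule out_PC_cases) blast
    obtain B d \<psi> g where n_def: "n = (?s, (B, d), \<psi>, g)" and B: "B \<in> U"
      and d: "d \<in> El B \<rightarrow>\<^sub>E Ob C"
      and \<psi>: "\<psi> \<in> El B \<rightarrow>\<^sub>E El (fst ?s)" and g_ext: "g \<in> extensional (El B)"
      and g: "\<And>a. a \<in> El B \<Longrightarrow> g a \<in> out C (snd ?s (\<psi> a))"
      and g_cod: "\<And>a. a \<in> El B \<Longrightarrow> Cod C (g a) = d a"
      using n by (rule out_PC_cases) blast
    have "U.code (A', \<lambda>a\<in>El A'. fan_code ?s (\<phi> a, f a)) = U.code (B, \<lambda>a\<in>El B. fan_code ?s (\<psi> a, g a))"
      using eq act_eq[OF m m_def] act_eq[OF n n_def] f g by simp
    then have "A' = B" and x_eq: "(\<lambda>a\<in>El A'. fan_code ?s (\<phi> a, f a)) = (\<lambda>a\<in>El B. fan_code ?s (\<psi> a, g a))"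
      by (subst (asm) U.code_eq_iff[where X = UNIV and Y = UNIV]; use A' B in simp)+
    have ptw: "\<phi> a = \<psi> a \<and> f a = g a" if a: "a \<in> El A'" for a
    proof -
      have a': "a \<in> El B"
        using a \<open>A' = B\<close> by simp
      have "fan_code ?s (\<phi> a, f a) = fan_code ?s (\<psi> a, g a)"
        using fun_cong[OF x_eq, of a] a a' by simp
      moreover have "(\<phi> a, f a) \<in> fan ?s" "(\<psi> a, g a) \<in> fan ?s"
        using PiE_mem[OF \<phi> a] f[OF a] PiE_mem[OF \<psi> a'] g[OF a'] unfolding fan_def by blast+
      ultimately have "(\<phi> a, f a) = (\<psi> a, g a)"
        by (rule inj_onD[OF code_inj])
      then show ?thesis
        by simp
    qed
    have "\<phi> = \<psi>"
      by (rule PiE_ext[OF \<phi>]) (use \<psi> ptw \<open>A' = B\<close> in auto)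
    moreover have "f = g"
      by (rule extensionalityI[OF f_ext]) (use g_ext ptw \<open>A' = B\<close> in auto)
    moreover have "c' = d"
      by (rule PiE_ext[OF c']) (use d ptw f_cod g_cod \<open>A' = B\<close> in force)+
    ultimately show "m = n"
      using \<open>A' = B\<close> by (simp add: m_def n_def)
  qed
  show "act ?s (gen ?s) ` out PC ?s = fobj u (rep ?s)"
  proof (rule subset_antisym)
    show "act ?s (gen ?s) ` out PC ?s \<subseteq> fobj u (rep ?s)"
      using act_in[OF params_gen[OF s]] by blast
    show "fobj u (rep ?s) \<subseteq> act ?s (gen ?s) ` out PC ?s"
    proof
      fix v assume "v \<in> fobj u (rep ?s)"
      then obtain A' y where A': "A' \<in> U" and y: "y \<in> El A' \<rightarrow>\<^sub>E rep ?s" and v: "v = U.code (A', y)"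
        by (rule U.poly_cases)
      have "\<exists>p\<in>fan ?s. y a = fan_code ?s p" if "a \<in> El A'" for a
        using PiE_mem[OF y that] by blast
      then obtain p where p: "\<And>a. a \<in> El A' \<Longrightarrow> p a \<in> fan ?s \<and> y a = fan_code ?s (p a)"
        by metis
      define \<phi> where "\<phi> = (\<lambda>a\<in>El A'. fst (p a))"
      define f where "f = (\<lambda>a\<in>El A'. snd (p a))"
      \<comment> \<open>The object family of the target is forced: its entries are the codomains of
        the components. This is why an element of \<open>u (rep s)\<close> carries exactly the data
        of a morphism.\<close>
      define c' where "c' = (\<lambda>a\<in>El A'. Cod C (f a))"
      have \<phi>: "\<phi> \<in> El A' \<rightarrow>\<^sub>E El (fst ?s)"
        using p unfolding \<phi>_def fan_def by fastforce
      have f: "f a \<in> out C (snd ?s (\<phi> a))" if "a \<in> El A'" for a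
        using p[OF that] that unfolding \<phi>_def f_def fan_def by auto
      have c': "c' \<in> El A' \<rightarrow>\<^sub>E Ob C"
        using C.Cod_out[OF f] unfolding c'_def by simp
      have m: "(?s, (A', c'), \<phi>, f) \<in> out PC ?s"
        using s A' c' \<phi> f by (simp add: out_def Arr_PC_iff) (simp add: Ob_PC f_def c'_def)
      have "(\<lambda>a\<in>El A'. fan_code ?s (\<phi> a, f a)) = y"
        by (rule extensionalityI[where A = "El A'"])
          (use y p in \<open>auto simp: \<phi>_def f_def PiE_iff\<close>)
      then have "v = act ?s (gen ?s) (?s, (A', c'), \<phi>, f)"
        using act_eq[OF m refl] f v by simp
      then show "v \<in> act ?s (gen ?s) ` out PC ?s"
        using m by blast
    qed
  qed
qed

text \<open>Transport along the bijection of \<open>act_bij\<close>. It turns the second component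
  \<open>y\<close> of an element of \<open>P.K X\<close> into a map from \<open>u (rep s)\<close> to
  \<open>X\<close>, on which an arbitrary functor \<open>r\<close> can act.\<close>

definition extend :: "('a, 'b, 'o) pc_ob \<Rightarrow> (('a, 'b, 'o, 'm) pc_arr \<Rightarrow> 'v) \<Rightarrow> 'v \<Rightarrow> 'v" where
  "extend s y = (\<lambda>q\<in>fobj u (rep s). y (inv_into (out PC s) (act s (gen s)) q))"

lemma extend_in:
  assumes s: "(A, c) \<in> Ob PC" and y: "y \<in> out PC (A, c) \<rightarrow>\<^sub>E X"
  shows "extend (A, c) y \<in> fobj u (rep (A, c)) \<rightarrow>\<^sub>E X"
  unfolding extend_def restrict_PiE_iff
proof
  fix q assume "q \<in> fobj u (rep (A, c))"
  then have "inv_into (out PC (A, c)) (act (A, c) (gen (A, c))) q \<in> out PC (A, c)"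
    using act_bij[OF s] inv_into_into unfolding bij_betw_def by metis
  then show "y (inv_into (out PC (A, c)) (act (A, c) (gen (A, c))) q) \<in> X"
    by (rule PiE_mem[OF y])
qed

lemma extend_act:
  assumes s: "(A, c) \<in> Ob PC" and y: "y \<in> extensional (out PC (A, c))"
  shows "compose (out PC (A, c)) (extend (A, c) y) (act (A, c) (gen (A, c))) = y"
proof (rule extensionalityI[OF compose_extensional y])
  fix m assume m: "m \<in> out PC (A, c)"
  then have "act (A, c) (gen (A, c)) m \<in> fobj u (rep (A, c))"
    using act_in[OF params_gen[OF s]] by blast
  moreover have "inv_into (out PC (A, c)) (act (A, c) (gen (A, c))) (act (A, c) (gen (A, c)) m) = m"
    using act_bij[OF s] m unfolding bij_betw_def by simp
  ultimately show "compose (out PC (A, c)) (extend (A, c) y) (act (A, c) (gen (A, c))) m = y m"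
    using m by (simp add: compose_eq extend_def)
qed

lemma extend_unique:
  assumes s: "(A, c) \<in> Ob PC" and h: "h \<in> extensional (fobj u (rep (A, c)))"
    and y: "compose (out PC (A, c)) h (act (A, c) (gen (A, c))) = y"
  shows "extend (A, c) y = h"
proof (rule extensionalityI[OF _ h])
  fix q assume q: "q \<in> fobj u (rep (A, c))"
  then obtain m where m: "m \<in> out PC (A, c)" and q_def: "q = act (A, c) (gen (A, c)) m"
    using act_bij[OF s] unfolding bij_betw_def by blast
  have "inv_into (out PC (A, c)) (act (A, c) (gen (A, c))) q = m"
    using act_bij[OF s] m unfolding bij_betw_def q_def by simp
  moreover have "h q = y m"
    using m unfolding q_def y[symmetric] by (simp add: compose_eq)
  ultimately show "extend (A, c) y q = h q"
    using q by (simp add: extend_def)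
qed (simp add: extend_def)

lemma extend_compose:
  assumes s: "(A, c) \<in> Ob PC" and y: "y \<in> out PC (A, c) \<rightarrow>\<^sub>E X"
  shows "extend (A, c) (compose (out PC (A, c)) g y)
    = compose (fobj u (rep (A, c))) g (extend (A, c) y)"
proof (rule extend_unique[OF s])
  have "act (A, c) (gen (A, c)) m \<in> fobj u (rep (A, c))" if "m \<in> out PC (A, c)" for m
    using act_in[OF params_gen[OF s]] that by blast
  moreover have "extend (A, c) y (act (A, c) (gen (A, c)) m) = y m" if "m \<in> out PC (A, c)" for m
    using fun_cong[OF extend_act[OF s, of y], of m] y that by (simp add: PiE_iff compose_eq)
  ultimately show "compose (out PC (A, c)) (compose (fobj u (rep (A, c))) g (extend (A, c) y))
      (act (A, c) (gen (A, c))) = compose (out PC (A, c)) g y"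
    unfolding compose_def by (intro restrict_ext) simp
qed simp

text \<open>Yoneda for the summand at \<open>(A, c)\<close>: the map \<open>g\<close> takes the code
  of \<open>(a, h)\<close> to \<open>x a h\<close>. The two equations say that the element of
  \<open>u (k X)\<close> and the map attached to its image under the unit both arise from this
  single \<open>g\<close>, so naturality at \<open>g\<close> relates them.\<close>

lemma classify:
  assumes p: "params A c x X"
  obtains g where "g \<in> rep (A, c) \<rightarrow>\<^sub>E X" "extend (A, c) (act (A, c) x) = fmor u (rep (A, c)) X g"
    "elt A c x = fmor u (fobj C.K (rep (A, c))) (fobj C.K X) (fmor C.K (rep (A, c)) X g) (elt A c (gen (A, c)))"
proof -
  let ?s = "(A, c)"
  note s = paramsD(1)[OF p] and pg = params_gen[OF paramsD(1)[OF p]]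
  define g where "g = (\<lambda>p\<in>rep ?s. case inv_into (fan ?s) (fan_code ?s) p of (a, h) \<Rightarrow> x a h)"
  have g_code: "g (fan_code ?s (a, h)) = x a h" if "a \<in> El A" "h \<in> out C (c a)" for a h
    using that fan_code(1)[OF s] unfolding g_def fan_def by simp
  have g: "g \<in> rep ?s \<rightarrow>\<^sub>E X"
  proof (rule PiE_I)
    fix p assume "p \<in> rep ?s"
    then obtain a h where "p = fan_code ?s (a, h)" "a \<in> El A" "h \<in> out C (c a)"
      unfolding fan_def by auto
    then show "g p \<in> X"
      using g_code paramsD(5)[OF p] by fastforce
  qed (simp add: g_def)
  have gx: "compose (out C (c a)) g (gen ?s a) = x a" if a: "a \<in> El A" for a
    by (rule extensionalityI[where A = "out C (c a)"])
      (use paramsD(5)[OF p a] g_code[OF a] in \<open>auto simp: gen_def compose_eq PiE_iff\<close>)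
  have "act ?s (\<lambda>a. compose (out C (c a)) g (gen ?s a)) = act ?s x"
    by (rule act_cong) (simp add: gx)
  then have "extend ?s (act ?s x) = fmor u (rep ?s) X g"
    using fmor_u_act[OF pg, of X g] by (intro extend_unique[OF s] U.fmor_poly_extensional) simp
  moreover have "elt A c (\<lambda>a. compose (out C (c a)) g (gen ?s a)) = elt A c x"
    unfolding elt_def by (metis (no_types, lifting) gx restrict_ext)
  ultimately show thesis
    using that[OF g] fmor_uK_elt[OF pg, of X g] by simp
qed

lemma PK_cases:
  assumes "v \<in> fobj P.K X"
  obtains A c y where "(A, c) \<in> Ob PC" "y \<in> out PC (A, c) \<rightarrow>\<^sub>E X" "v = P.code ((A, c), y)"
proof -
  obtain s y where "s \<in> Ob PC" "y \<in> out PC s \<rightarrow>\<^sub>E X" "v = P.code (s, y)"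
    using assms by (rule P.poly_cases)
  then show thesis
    using that by (cases s) blast
qed

text \<open>By Yoneda a transformation \<theta> is known from its values \<open>t s\<close> at the
  generic elements, and \<sigma> sends \<open>(s, y)\<close> to the image of \<open>t s\<close>
  under \<open>r\<close> of \<open>extend s y\<close>. That \<sigma> restricts to \<theta> along the
  unit is naturality of \<theta> at the map found by \<open>classify\<close>.\<close>

lemma left_kan_PC: "is_left_kan u (u \<circ>\<^sub>F C.K) P.K unit"
  unfolding is_left_kan_def
proof (intro conjI allI impI)
  show "set_functor P.K"
    by (rule P.poly_functor.set_functor_axioms)
  show "nat_trans (u \<circ>\<^sub>F C.K) (P.K \<circ>\<^sub>F u) unit"
    by (rule unit_nat)
  fix r :: "'v setfun" and \<theta> assume "set_functor r \<and> nat_trans (u \<circ>\<^sub>F C.K) (r \<circ>\<^sub>F u) \<theta>"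
  then have r: "set_functor r" and \<theta>: "nat_trans (u \<circ>\<^sub>F C.K) (r \<circ>\<^sub>F u) \<theta>"
    by blast+
  define t where "t s = \<theta> (rep s) (elt (fst s) (snd s) (gen s))" for s
  define \<sigma> where "\<sigma> X = (\<lambda>v\<in>fobj P.K X. case poly_decode (Ob PC) (out PC) v of
    (s, y) \<Rightarrow> fmor r (fobj u (rep s)) X (extend s y) (t s))" for X
  have t_in: "t (A, c) \<in> fobj r (fobj u (rep (A, c)))" if s: "(A, c) \<in> Ob PC" for A c
    using nat_trans_apply[OF \<theta> fan_code(2)[OF s]] elt_in(2)[OF params_gen[OF s]] by (simp add: t_def)
  have urep: "fobj u (rep (A, c)) \<in> Sets" if s: "(A, c) \<in> Ob PC" for A c
    by (rule U.poly_functor.obj_closed[OF fan_code(2)[OF s]])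
  have \<sigma>_code: "\<sigma> X (P.code ((A, c), y)) = fmor r (fobj u (rep (A, c))) X (extend (A, c) y) (t (A, c))"
    if "(A, c) \<in> Ob PC" "y \<in> out PC (A, c) \<rightarrow>\<^sub>E X" for X A c y
    using P.code_in_poly[OF that] P.poly_decode_code[OF that] by (simp add: \<sigma>_def)
  have \<sigma>: "nat_trans P.K r \<sigma>"
  proof (rule nat_transI)
    fix X :: "'v set" and v assume X: "X \<in> Sets" and v_in: "v \<in> fobj P.K X"
    obtain A c y where s: "(A, c) \<in> Ob PC" and y: "y \<in> out PC (A, c) \<rightarrow>\<^sub>E X"
      and v: "v = P.code ((A, c), y)"
      using v_in by (rule PK_cases)
    show "\<sigma> X v \<in> fobj r X"
      unfolding v \<sigma>_code[OF s y] by (rule fmor_apply[OF r urep[OF s] X extend_in[OF s y] t_in[OF s]])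
    fix Y :: "'v set" and g assume Y: "Y \<in> Sets" and g: "g \<in> X \<rightarrow>\<^sub>E Y"
    have "\<sigma> Y (fmor P.K X Y g v)
        = fmor r (fobj u (rep (A, c))) Y (extend (A, c) (compose (out PC (A, c)) g y)) (t (A, c))"
      unfolding v P.fmor_poly_code[OF s y] by (rule \<sigma>_code[OF s compose_PiE[OF y g]])
    also have "\<dots> = fmor r X Y g (\<sigma> X v)"
      unfolding v \<sigma>_code[OF s y] extend_compose[OF s y]
      by (rule fmor_compose[OF r urep[OF s] X Y extend_in[OF s y] g t_in[OF s]])
    finally show "\<sigma> Y (fmor P.K X Y g v) = fmor r X Y g (\<sigma> X v)" .
  qed (simp add: \<sigma>_def)
  moreover have "nt_eq (vcomp (u \<circ>\<^sub>F C.K) (whisk_right \<sigma> u) unit) \<theta>"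
  proof (rule nt_eqI[where F = "u \<circ>\<^sub>F C.K"])
    fix X :: "'v set" and v assume X: "X \<in> Sets" and v: "v \<in> fobj (u \<circ>\<^sub>F C.K) X"
    then have "v \<in> fobj u (fobj C.K X)"
      by simp
    then obtain A c x where p: "params A c x X" and v_def: "v = elt A c x"
      by (rule elt_cases)
    note s = paramsD(1)[OF p]
    obtain g where g: "g \<in> rep (A, c) \<rightarrow>\<^sub>E X"
      and ext: "extend (A, c) (act (A, c) x) = fmor u (rep (A, c)) X g"
      and elt: "elt A c x = fmor u (fobj C.K (rep (A, c))) (fobj C.K X) (fmor C.K (rep (A, c)) X g)
        (elt A c (gen (A, c)))"
      using p by (rule classify)
    have "\<sigma> (fobj u X) (unit X v) = fmor r (fobj u (rep (A, c))) (fobj u X) (fmor u (rep (A, c)) X g) (t (A, c))"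
      unfolding v_def unit_elt[OF p] \<sigma>_code[OF s act_in[OF p]] ext ..
    also have "\<dots> = \<theta> X v"
      using nat_trans_natural[OF \<theta> fan_code(2)[OF s] X g] elt_in(2)[OF params_gen[OF s]]
      unfolding v_def elt by (simp add: t_def)
    finally show "vcomp (u \<circ>\<^sub>F C.K) (whisk_right \<sigma> u) unit X v = \<theta> X v"
      using v by (simp add: whisk_right_def)
  qed (rule vcomp_extensional, rule nat_trans_extensional[OF \<theta>])
  moreover have "nt_eq \<sigma>' \<sigma>"
    if \<sigma>': "nat_trans P.K r \<sigma>'" and eq: "nt_eq (vcomp (u \<circ>\<^sub>F C.K) (whisk_right \<sigma>' u) unit) \<theta>" for \<sigma>'
  proof (rule nt_eqI[where F = P.K])
    fix X :: "'v set" and v assume X: "X \<in> Sets" and v_in: "v \<in> fobj P.K X"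
    obtain A c y where s: "(A, c) \<in> Ob PC" and y: "y \<in> out PC (A, c) \<rightarrow>\<^sub>E X"
      and v: "v = P.code ((A, c), y)"
      using v_in by (rule PK_cases)
    note pg = params_gen[OF s]
    let ?w = "P.code ((A, c), act (A, c) (gen (A, c)))"
    have w: "?w \<in> fobj P.K (fobj u (rep (A, c)))"
      by (rule P.code_in_poly[OF s act_in[OF pg]])
    \<comment> \<open>Each element of the summand at \<open>(A, c)\<close> is the image, under
      \<open>extend (A, c) y\<close>, of the value \<open>?w\<close> of the unit at the generic
      element. A competing \<sigma>' is prescribed there by \<theta>, so naturality leaves no
      choice.\<close>
    have "v = fmor P.K (fobj u (rep (A, c))) X (extend (A, c) y) ?w"
      unfolding P.fmor_poly_code[OF s act_in[OF pg]] using extend_act[OF s, of y] y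
      by (simp add: v PiE_iff)
    then have "\<sigma>' X v = fmor r (fobj u (rep (A, c))) X (extend (A, c) y) (\<sigma>' (fobj u (rep (A, c))) ?w)"
      using nat_trans_natural[OF \<sigma>' urep[OF s] X extend_in[OF s y] w] by simp
    also have "\<sigma>' (fobj u (rep (A, c))) ?w = t (A, c)"
      using nt_eqD[OF eq fan_code(2)[OF s], of "elt A c (gen (A, c))"] elt_in(2)[OF pg]
      by (simp add: unit_elt[OF pg] whisk_right_def t_def)
    finally show "\<sigma>' X v = \<sigma> X v"
      unfolding v \<sigma>_code[OF s y] .
  qed (rule nat_trans_extensional[OF \<sigma>'], assumption, simp add: \<sigma>_def)
  ultimately show "\<exists>\<sigma>. nat_trans P.K r \<sigma> \<and> nt_eq (vcomp (u \<circ>\<^sub>F C.K) (whisk_right \<sigma> u) unit) \<theta> \<and>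
      (\<forall>\<sigma>'. nat_trans P.K r \<sigma>' \<and> nt_eq (vcomp (u \<circ>\<^sub>F C.K) (whisk_right \<sigma>' u) unit) \<theta> \<longrightarrow> nt_eq \<sigma>' \<sigma>)"
    by blast
qed

section \<open>Counit and comultiplication of the completion, evaluated on the unit of the
  extension\<close>

lemma counit_PC_unit:
  assumes p: "params A c x X"
  shows "counit (cat_comonad PC) (fobj u X) (unit X (elt A c x))
    = fmor u (fobj C.K X) X (counit (cat_comonad C) X) (elt A c x)"
proof -
  note s = paramsD(1)[OF p]
  \<comment> \<open>The identity of \<open>(A, c)\<close> has the identity as index function and
    identities as components, so evaluation there is the counit of \<open>C\<close> applied in each
    entry.\<close>
  have "act (A, c) x (Ide PC (A, c)) = U.code (A, \<lambda>a\<in>El A. x a (Ide C (c a)))"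
    using P.Ide_out[OF s]
    by (auto simp: act_def pull_def Ide_PC intro!: arg_cong[where f = U.code] restrict_ext)
  moreover have "compose (El A) (counit (cat_comonad C) X) (\<lambda>a\<in>El A. C.code (c a, x a))
      = (\<lambda>a\<in>El A. x a (Ide C (c a)))"
    unfolding compose_def by (rule restrict_ext) (simp add: C.counit_code[OF paramsD(4,5)[OF p]])
  ultimately show ?thesis
    unfolding unit_elt[OF p] P.counit_code[OF s act_in[OF p]]
    by (simp add: elt_def U.fmor_poly_code[OF paramsD(2)[OF p] elt_in(1)[OF p]])
qed

lemma fmor_comult_elt:
  assumes p: "params A c x X"
  shows "fmor u (fobj C.K X) (fobj C.K (fobj C.K X)) (comult (cat_comonad C) X) (elt A c x)
    = elt A c (\<lambda>a. C.splay (c a) (x a))"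
proof -
  have "compose (El A) (comult (cat_comonad C) X) (\<lambda>a\<in>El A. C.code (c a, x a))
      = (\<lambda>a\<in>El A. C.code (c a, C.splay (c a) (x a)))"
    unfolding compose_def by (rule restrict_ext) (simp add: C.comult_code[OF paramsD(4,5)[OF p]])
  then show ?thesis
    unfolding elt_def U.fmor_poly_code[OF paramsD(2)[OF p] elt_in(1)[OF p]] by (rule arg_cong)
qed

text \<open>Shifting along a morphism \<open>m\<close> to \<open>(A', c')\<close> replaces
  \<open>x\<close> by the family \<open>?x'\<close> of shifts of \<open>x (\<phi> a)\<close> along
  \<open>f a\<close>; that the results agree is the formula for composition in the completion. On
  the other side, \<open>C.splay\<close> at \<open>f a\<close> yields the code of that same shift
  with index \<open>c' a\<close>, so applying \<open>unit\<close> reassembles the index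
  \<open>(A', c')\<close>.\<close>

lemma splay_act:
  assumes p: "params A c x X"
  shows "P.splay (A, c) (act (A, c) x)
    = compose (out PC (A, c)) (unit X) (act (A, c) (\<lambda>a. C.splay (c a) (x a)))"
  unfolding P.splay_def compose_def
proof (rule restrict_ext)
  fix m assume m: "m \<in> out PC (A, c)"
  obtain A' c' \<phi> f where m_def: "m = ((A, c), (A', c'), \<phi>, f)" and A': "A' \<in> U"
    and c': "c' \<in> El A' \<rightarrow>\<^sub>E Ob C" and \<phi>: "\<phi> \<in> El A' \<rightarrow>\<^sub>E El (fst (A, c))"
    and f: "\<And>a. a \<in> El A' \<Longrightarrow> f a \<in> out C (snd (A, c) (\<phi> a))"
    and f_cod: "\<And>a. a \<in> El A' \<Longrightarrow> Cod C (f a) = c' a"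
    using m by (rule out_PC_cases) blast
  have \<phi>A: "\<phi> a \<in> El A" and fa: "f a \<in> out C (c (\<phi> a))" if "a \<in> El A'" for a
    using PiE_mem[OF \<phi> that] f[OF that] by simp_all
  let ?x' = "\<lambda>a. C.shift (x (\<phi> a)) (f a)"
  have p': "params A' c' ?x' X"
    unfolding params_def
  proof (intro conjI ballI)
    fix a assume a: "a \<in> El A'"
    show "?x' a \<in> out C (c' a) \<rightarrow>\<^sub>E X"
      using C.shift_in[OF paramsD(5)[OF p \<phi>A[OF a]] fa[OF a]] unfolding f_cod[OF a] .
  qed (simp add: Ob_PC A' c')
  have "(\<lambda>a\<in>El A'. C.splay (c (\<phi> a)) (x (\<phi> a)) (f a)) = (\<lambda>a\<in>El A'. C.code (c' a, ?x' a))"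
    by (rule restrict_ext) (simp add: C.splay_def fa f_cod)
  then have "act (A, c) (\<lambda>a. C.splay (c a) (x a)) m = elt A' c' ?x'"
    using m by (simp add: act_def pull_def m_def elt_def)
  then have "unit X (act (A, c) (\<lambda>a. C.splay (c a) (x a)) m) = P.code ((A', c'), act (A', c') ?x')"
    by (simp add: unit_elt[OF p'])
  moreover have "P.shift (act (A, c) x) m = act (A', c') ?x'"
    unfolding P.shift_def act_def[of "(A', c')"] m_def Cod_PC
  proof (rule restrict_ext)
    fix n assume n: "n \<in> out PC (A', c')"
    obtain A'' c'' \<psi> g where n_def: "n = ((A', c'), (A'', c''), \<psi>, g)"
      and \<psi>: "\<psi> \<in> El A'' \<rightarrow>\<^sub>E El (fst (A', c'))"
      and g: "\<And>a. a \<in> El A'' \<Longrightarrow> g a \<in> out C (snd (A', c') (\<psi> a))"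
      using n by (rule out_PC_cases) blast
    have \<psi>A: "\<psi> a \<in> El A'" and ga: "g a \<in> out C (c' (\<psi> a))" if "a \<in> El A''" for a
      using PiE_mem[OF \<psi> that] g[OF that] by simp_all
    have nm: "Comp PC n m \<in> out PC (A, c)"
      using P.Comp_out(1)[OF m] n by (simp add: m_def)
    have "(\<lambda>a\<in>El A''. x (compose (El A'') \<phi> \<psi> a) ((\<lambda>a\<in>El A''. Comp C (g a) (f (\<psi> a))) a))
        = (\<lambda>a\<in>El A''. ?x' (\<psi> a) (g a))"
      by (rule restrict_ext) (simp add: compose_eq C.shift_def f_cod \<psi>A ga)
    then show "act (A, c) x (Comp PC n ((A, c), (A', c'), \<phi>, f)) = pull ?x' n"
      using nm by (simp add: act_def pull_def n_def m_def Comp_PC del: restrict_apply add: restrict_apply')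
  qed
  ultimately show "P.code (Cod PC m, P.shift (act (A, c) x) m)
      = unit X (act (A, c) (\<lambda>a. C.splay (c a) (x a)) m)"
    by (simp add: m_def)
qed

lemma comult_PC_unit:
  assumes p: "params A c x X"
  shows "comult (cat_comonad PC) (fobj u X) (unit X (elt A c x))
    = fmor P.K (fobj u (fobj C.K X)) (fobj P.K (fobj u X)) (unit X)
        (unit (fobj C.K X)
          (fmor u (fobj C.K X) (fobj C.K (fobj C.K X)) (comult (cat_comonad C) X) (elt A c x)))"
proof -
  note s = paramsD(1)[OF p]
  have p': "params A c (\<lambda>a. C.splay (c a) (x a)) (fobj C.K X)"
    using p C.splay_in unfolding params_def by blast
  show ?thesis
    unfolding fmor_comult_elt[OF p] unit_elt[OF p] unit_elt[OF p'] P.comult_code[OF s act_in[OF p]]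
      P.fmor_poly_code[OF s act_in[OF p']] splay_act[OF p] ..
qed

lemma lan_comonad_PC: "is_lan_comonad u (cat_comonad C) (cat_comonad PC)"
  unfolding is_lan_comonad_def Let_def C.func_cat_comonad P.func_cat_comonad
proof (intro exI[of _ unit] conjI)
  show "is_left_kan u (u \<circ>\<^sub>F C.K) P.K unit"
    by (rule left_kan_PC)
  show "nat_trans P.K id_functor (counit (cat_comonad PC))"
    by (rule P.counit_nat)
  show "nat_trans P.K (P.K \<circ>\<^sub>F P.K) (comult (cat_comonad PC))"
    by (rule P.comult_nat)
  show "nt_eq (vcomp (u \<circ>\<^sub>F C.K) (whisk_right (counit (cat_comonad PC)) u) unit)
      (whisk_left u C.K id_functor (counit (cat_comonad C)))"
  proof (rule nt_eqI[where F = "u \<circ>\<^sub>F C.K"])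
    fix X :: "'v set" and v assume v: "v \<in> fobj (u \<circ>\<^sub>F C.K) X"
    then have "v \<in> fobj u (fobj C.K X)"
      by simp
    then obtain A c x where p: "params A c x X" "v = elt A c x"
      by (rule elt_cases)
    then show "vcomp (u \<circ>\<^sub>F C.K) (whisk_right (counit (cat_comonad PC)) u) unit X v
        = whisk_left u C.K id_functor (counit (cat_comonad C)) X v"
      using v counit_PC_unit[OF p(1)] by (simp add: whisk_left_def whisk_right_def)
  qed (rule vcomp_extensional, simp add: whisk_left_def U.fmor_poly_extensional)
  show "nt_eq (vcomp (u \<circ>\<^sub>F C.K) (whisk_right (comult (cat_comonad PC)) u) unit)
      (vcomp (u \<circ>\<^sub>F C.K) (whisk_left P.K (u \<circ>\<^sub>F C.K) (P.K \<circ>\<^sub>F u) unit)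
        (vcomp (u \<circ>\<^sub>F C.K) (whisk_right unit C.K)
          (whisk_left u C.K (C.K \<circ>\<^sub>F C.K) (comult (cat_comonad C)))))"
  proof (rule nt_eqI[where F = "u \<circ>\<^sub>F C.K"])
    fix X :: "'v set" and v assume v: "v \<in> fobj (u \<circ>\<^sub>F C.K) X"
    then have "v \<in> fobj u (fobj C.K X)"
      by simp
    then obtain A c x where p: "params A c x X" "v = elt A c x"
      by (rule elt_cases)
    then show "vcomp (u \<circ>\<^sub>F C.K) (whisk_right (comult (cat_comonad PC)) u) unit X v
        = vcomp (u \<circ>\<^sub>F C.K) (whisk_left P.K (u \<circ>\<^sub>F C.K) (P.K \<circ>\<^sub>F u) unit)
        (vcomp (u \<circ>\<^sub>F C.K) (whisk_right unit C.K)
          (whisk_left u C.K (C.K \<circ>\<^sub>F C.K) (comult (cat_comonad C)))) X v"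
      using v comult_PC_unit[OF p(1)] by (simp add: whisk_left_def whisk_right_def)
  qed (rule vcomp_extensional)+
qed

end

section \<open>The category corresponding to the extension, and its uniqueness\<close>

theorem proposition5p5:
  fixes U :: "'a set" and El :: "'a \<Rightarrow> 'b set" and C :: "('o, 'm) cat"
  assumes "set_universe TYPE('v)"
    and "small TYPE('v) U" and "\<And>A. A \<in> U \<Longrightarrow> small TYPE('v) (El A)"
    and "small_category TYPE('v) C"
  shows "(\<exists>l :: 'v comonad_data. is_lan_comonad (poly U El) (cat_comonad C) l) \<and>
    (\<forall>l :: 'v comonad_data. is_lan_comonad (poly U El) (cat_comonad C) l \<longrightarrow>
      comonad l \<and>
      corresponding_category l (product_completion U El C) \<and>
      (\<forall>E :: ('p, 'n) cat. corresponding_category l E \<longrightarrow>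
        category_isomorphic E (product_completion U El C)))"
proof -
  have small_cat: "small_cat TYPE('v) D" if "small_category TYPE('v) D" for D :: "('x, 'y) cat"
    using that assms(1) unfolding small_category_def small_cat_def small_cat_axioms_def by blast
  interpret small_family_cat "TYPE('v)" U El C
    unfolding small_family_cat_def small_family_def
    using assms small_cat by blast
  let ?k = "cat_comonad C :: 'v comonad_data" and ?kP = "cat_comonad PC :: 'v comonad_data"
  have "comonad l \<and> corresponding_category l PC \<and>
      (\<forall>E :: ('p, 'n) cat. corresponding_category l E \<longrightarrow> category_isomorphic E PC)"
    if l: "is_lan_comonad u ?k l" for l :: "'v comonad_data"
  proof -
    have L: "set_functor (func l)" and nat: "nat_trans (func l) id_functor (counit l)"
        "nat_trans (func l) (func l \<circ>\<^sub>F func l) (comult l)"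
      using l by (rule is_lan_comonadE, blast)+
    \<comment> \<open>Uniqueness is applied in both orders, so no comonad isomorphism has to be
      inverted. The map from \<open>l\<close> gives the corresponding category; the map to
      \<open>l\<close> transports the laws and is composed with the isomorphism to the comonad of a
      further category \<open>E\<close>.\<close>
    have iso: "comonad_isomorphic l ?kP" "comonad_isomorphic ?kP l"
      using lan_comonad_unique[OF U.poly_functor.set_functor_axioms C.comonad_cat_comonad]
        l lan_comonad_PC by blast+
    have "comonad l"
      by (rule comonad_transport[OF P.comonad_cat_comonad iso(2) L nat])
    moreover have "corresponding_category l PC"
      unfolding corresponding_category_def small_category_def
      using iso(1) category_PC small_Ob_PC small_Arr_PC by blast
    moreover have "category_isomorphic E PC" if "corresponding_category l E" for E :: "('p, 'n) cat"
    proof -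
      have "small_category TYPE('v) E" and lE: "comonad_isomorphic l (cat_comonad E)"
        using that unfolding corresponding_category_def by blast+
      then interpret E: small_cat "TYPE('v)" E
        using small_cat by blast
      have "comonad_isomorphic ?kP (cat_comonad E)"
        by (rule comonad_isomorphic_trans[OF _ _ _ L _ iso(2) lE])
          (simp_all add: P.poly_functor.set_functor_axioms E.poly_functor.set_functor_axioms
            P.counit_nat P.comult_nat)
      then show ?thesis
        by (rule category_isomorphic_if_comonad_isomorphic[OF P.small_cat_axioms E.small_cat_axioms])
    qed
    ultimately show ?thesis
      by blast
  qed
  then show ?thesis
    using lan_comonad_PC by blast
qed

end
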